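(* Let $\boldsymbol{\mathfrak a}=(\mathfrak a_1,\dots,\mathfrak a_r)\subseteq(\mathcal O_{X,O})^r$ be a tuple of ideals and run the algorithm described in the context on a common log-resolution of $\boldsymbol{\mathfrak a}$. Let $j$ be a step of the algorithm at which step $(j.3)$ is performed, and let $\boldsymbol\lambda_j$ be the point chosen at step $(j.1)$. Then the constancy region of $\boldsymbol\lambda_j$ is computed at step $(j.3)$, that is, $$\mathcal C(j)=\mathcal C_{\boldsymbol{\mathfrak a}}(\boldsymbol\lambda_j),$$ and one interior point for each $\mathcal C$-facet of $\mathcal C_{\boldsymbol{\mathfrak a}}(\boldsymbol\lambda_j)$ is added to the set $N$.
   Context: Setup. $X$ is a normal complex surface and $O\in X$ is a point at which $X$ has at worst a rational singularity. One works locally at $O$. The $\mathfrak a_i$ are non-zero ideals of $\mathcal O_{X,O}$. Fix a common log-resolution $\pi:X'\to X$: birational, $X'$ smooth, $\mathfrak a_i\cdot\mathcal O_{X'}=\mathcal O_{X'}(-F_i)$ with $F_i$ effective Cartier, $\sum_iF_i+E$ with simple normal crossings, $E$ the exceptional locus (over $O$), a tree of smooth rational curves $E_1,\dots,E_s$. $K_\pi=\sum_{j=1}^sk_jE_j$ is the $\mathbb Q$-divisor with $(K_\pi+E_j)\cdot E_j=-2$ for $j=1,\dots,s$. Mixed multiplier ideal: $\mathcal J(\boldsymbol{\mathfrak a}^{\boldsymbol\lambda})=\pi_*\mathcal O_{X'}(\lceil K_\pi-\lambda_1F_1-\cdots-\lambda_rF_r\rceil)$ for $\boldsymbol\lambda\in\mathbb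 R^r_{\geqslant0}$. Region: $\mathcal R_{\boldsymbol{\mathfrak a}}(\boldsymbol\lambda)=\{\boldsymbol\lambda'\in\mathbb R_{\geqslant0}^r\mid\mathcal J(\boldsymbol{\mathfrak a}^{\boldsymbol\lambda'})\supseteq\mathcal J(\boldsymbol{\mathfrak a}^{\boldsymbol\lambda})\}$; it is a rational convex polytope, open in $\mathbb R_{\geqslant 0}^r$ (subspace topology). Constancy region: $\mathcal C_{\boldsymbol{\mathfrak a}}(\boldsymbol\lambda)=\{\boldsymbol\lambda'\in\mathbb R_{\geqslant0}^r\mid\mathcal J(\boldsymbol{\mathfrak a}^{\boldsymbol\lambda'})=\mathcal J(\boldsymbol{\mathfrak a}^{\boldsymbol\lambda})\}$. The supporting hyperplanes of $\mathcal R_{\boldsymbol{\mathfrak a}}(\boldsymbol\lambda)$ are the hyperplanes spanned by the facets of its boundary (boundary taken in $\mathbb R_{\geqslant0}^r$). A $\mathcal C$-facet of $\mathcal C_{\boldsymbol{\mathfrak a}}(\boldsymbol\lambda)$ is the intersection of the boundary of a connected component of $\mathcal C_{\boldsymbol{\mathfrak a}}(\boldsymbol\lambda)$ with a supporting hyperplane $H$ of $\mathcal R_{\boldsymbol{\mathfrak a}}(\boldsymbol\lambda)$ (its interior as a subspace of $H$ being non-empty). Interior points of a $\mathcal C$-facet are interior points with respect to $H$. Algorithm. $N$ and $D$ are ordered lists of points. Initially $N=\{\boldsymbol\lambda_0\}$ with $\boldsymbol\lambda_0=(0,\dots,0)$, and $D=\emptyset$. For $j=0,1,2,\dots$ perform: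 $(j.1)$ Let $\boldsymbol\lambda_j$ be the first point of $N$ and compute $\mathcal R_{\boldsymbol{\mathfrak a}}(\boldsymbol\lambda_j)$. If some $\boldsymbol\lambda\in N$ satisfies $\boldsymbol\lambda\in\mathcal R_{\boldsymbol{\mathfrak a}}(\boldsymbol\lambda_j)$ and $\mathcal J(\boldsymbol{\mathfrak a}^{\boldsymbol\lambda})\neq\mathcal J(\boldsymbol{\mathfrak a}^{\boldsymbol\lambda_j})$, move $\boldsymbol\lambda$ to the first place of $N$ and repeat $(j.1)$; otherwise go to $(j.2)$. (The point chosen at step $(j.1)$ is the point $\boldsymbol\lambda_j$ with which one passes to $(j.2)$.) $(j.2)$ If some $\boldsymbol\lambda\in D$ satisfies $\mathcal J(\boldsymbol{\mathfrak a}^{\boldsymbol\lambda})=\mathcal J(\boldsymbol{\mathfrak a}^{\boldsymbol\lambda_j})$, go to $(j.4)$; otherwise go to $(j.3)$. $(j.3)$ Compute $\mathcal C(j)=\mathcal R_{\boldsymbol{\mathfrak a}}(\boldsymbol\lambda_j)\setminus\bigcup_{i<j}\mathcal R_{\boldsymbol{\mathfrak a}}(\boldsymbol\lambda_i)$, the union being over all points chosen at previous steps. For each connected component of $\mathcal C(j)$ compute its outer facets, i.e. the intersections of its boundary with the supporting hyperplanes of $\mathcal R_{\boldsymbol{\mathfrak a}}(\boldsymbol\lambda_j)$. Pick one interior point in each outer facet of $\mathcal C(j)$ and add these points at the end of $N$. $(j.4)$ Delete $\boldsymbol\lambda_j$ from $N$ and add it at the end of $D$. *)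

theory Defs
  imports
    "HOL-Algebra.Generated_Rings"
    "HOL-Algebra.Ring_Divisibility"
    "HOL-Computational_Algebra.Polynomial"
    "HOL-Analysis.Analysis"
begin

text \<open>
  Integral schemes are represented in the classical language of models (Zariski--Samuel,
  \<^emph>\<open>Commutative Algebra\<close> II, Chapter VI): all schemes that occur here have the same function
  field \<^typ>\<open>'k::field\<close>, and such a scheme is the set of its local rings, each of them a subring
  of \<^typ>\<open>'k\<close>.  A point is identified with its local ring, the generic point is \<^term>\<open>UNIV\<close>, and
  \<^prop>\<open>P \<subseteq> Q\<close> means that \<^term>\<open>P\<close> lies in the closure of \<^term>\<open>Q\<close>.
\<close>

section \<open>Commutative algebra inside a field\<close>

definition ring_on :: "'k::field set \<Rightarrow> 'k ring" where
  "ring_on A = \<lparr>carrier = A, monoid.mult = (*), one = 1, ring.zero = 0, add = (+)\<rparr>"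

text \<open>For a local ring this is the maximal ideal.\<close>
definition max_ideal :: "'k::field set \<Rightarrow> 'k set" where
  "max_ideal A = A - Units (ring_on A)"

definition local_subring :: "'k::field set \<Rightarrow> bool" where
  "local_subring A \<longleftrightarrow> subring A (ring_on UNIV) \<and> maximalideal (max_ideal A) (ring_on A)"

definition valuation_subring :: "'k::field set \<Rightarrow> bool" where
  "valuation_subring W \<longleftrightarrow> subring W (ring_on UNIV) \<and> (\<forall>x. x \<in> W \<or> inverse x \<in> W)"

definition dominates :: "'k::field set \<Rightarrow> 'k set \<Rightarrow> bool" where
  "dominates W P \<longleftrightarrow> P \<subseteq> W \<and> max_ideal P \<subseteq> max_ideal W"

definition localization :: "'k::field set \<Rightarrow> 'k set \<Rightarrow> 'k set" where
  "localization A p = {x / y | x y. x \<in> A \<and> y \<in> A - p}"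

definition has_prime_chain :: "'k::field set \<Rightarrow> nat \<Rightarrow> bool" where
  "has_prime_chain A n \<longleftrightarrow>
     (\<exists>p :: nat \<Rightarrow> 'k set. (\<forall>i\<le>n. primeideal (p i) (ring_on A)) \<and> (\<forall>i<n. p i \<subset> p (Suc i)))"

definition has_krull_dim :: "'k::field set \<Rightarrow> nat \<Rightarrow> bool" where
  "has_krull_dim A n \<longleftrightarrow> has_prime_chain A n \<and> \<not> has_prime_chain A (Suc n)"

definition regular_parameters :: "'k::field set \<Rightarrow> 'k list \<Rightarrow> bool" where
  "regular_parameters P xs \<longleftrightarrow>
     set xs \<subseteq> P \<and> genideal (ring_on P) (set xs) = max_ideal P \<and> has_krull_dim P (length xs)"

definition regular_local_subring :: "'k::field set \<Rightarrow> bool" where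
  "regular_local_subring P \<longleftrightarrow>
     local_subring P \<and> noetherian_ring (ring_on P) \<and> (\<exists>xs. regular_parameters P xs)"

definition integrally_closed :: "'k::field set \<Rightarrow> bool" where
  "integrally_closed A \<longleftrightarrow>
     (\<forall>x. (\<exists>p. lead_coeff p = 1 \<and> (\<forall>i. Polynomial.coeff p i \<in> A) \<and> poly p x = 0) \<longrightarrow> x \<in> A)"


section \<open>Normal surface points and models over them\<close>

text \<open>
  \<^term>\<open>R\<close> is the local ring of a normal complex algebraic surface at a closed point, and the type
  \<^typ>\<open>'k\<close> is its field of fractions; \<^term>\<open>\<iota>\<close> is the structure map of the \<open>\<complex>\<close>-algebra \<^typ>\<open>'k\<close>.
\<close>
definition normal_surface_point :: "(complex \<Rightarrow> 'k::field) \<Rightarrow> 'k set \<Rightarrow> bool" where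
  "normal_surface_point \<iota> R \<longleftrightarrow>
     \<iota> \<in> ring_hom (ring_on UNIV) (ring_on UNIV) \<and>
     (\<exists>S M. finite S \<and>
        maximalideal M (ring_on (generate_ring (ring_on UNIV) (range \<iota> \<union> S))) \<and>
        R = localization (generate_ring (ring_on UNIV) (range \<iota> \<union> S)) M) \<and>
     (\<forall>x. \<exists>a\<in>R. \<exists>b\<in>R. b \<noteq> 0 \<and> x = a / b) \<and>
     integrally_closed R \<and>
     has_krull_dim R 2"

definition affine_model :: "'k::field set \<Rightarrow> 'k set set" where
  "affine_model A = {localization A p | p. primeideal p (ring_on A)}"

text \<open>
  An integral scheme that is proper and birational over \<open>Spec R\<close>: a finite union of spectra of
  finitely generated \<^term>\<open>R\<close>-algebras which satisfies the valuative criterion (uniqueness of the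
  dominated point is separatedness, existence is universal closedness).
\<close>
definition proper_birational_model :: "'k::field set \<Rightarrow> 'k set set \<Rightarrow> bool" where
  "proper_birational_model R X \<longleftrightarrow>
     (\<exists>\<A>. finite \<A> \<and>
        (\<forall>A\<in>\<A>. \<exists>S. finite S \<and> A = generate_ring (ring_on UNIV) (R \<union> S)) \<and>
        X = \<Union> (affine_model ` \<A>)) \<and>
     (\<forall>W. valuation_subring W \<and> R \<subseteq> W \<longrightarrow> (\<exists>!P. P \<in> X \<and> dominates W P))"

definition resolution :: "'k::field set \<Rightarrow> 'k set set \<Rightarrow> bool" where
  "resolution R X \<longleftrightarrow> proper_birational_model R X \<and> (\<forall>P\<in>X. regular_local_subring P)"

text \<open>
  The domains of definition \<open>{P \<in> X. x \<in> P}\<close> of rational functions generate the Zariski topology,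
  and the ring of regular functions on a nonempty open \<open>U\<close> is \<open>\<Inter>U\<close>.
\<close>
definition zariski :: "'k::field set set \<Rightarrow> 'k set topology" where
  "zariski X = topology_generated_by (range (\<lambda>x. {P \<in> X. x \<in> P}))"

text \<open>
  Vanishing of \<open>H\<^sup>1(X, \<O>\<^sub>X)\<close>, computed by Cech cocycles.  On a quasi-compact space finite covers
  suffice, and in degree one Cech cohomology is sheaf cohomology.
\<close>
definition H1_structure_sheaf_zero :: "'k::field set set \<Rightarrow> bool" where
  "H1_structure_sheaf_zero X \<longleftrightarrow>
     (\<forall>(n::nat) U s.
        (\<forall>i<n. openin (zariski X) (U i) \<and> U i \<noteq> {}) \<and> (\<Union>i<n. U i) = X \<and>
        (\<forall>i<n. \<forall>j<n. s i j \<in> \<Inter> (U i \<inter> U j)) \<and>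
        (\<forall>i<n. \<forall>j<n. \<forall>l<n. s i j + s j l = s i l)
        \<longrightarrow> (\<exists>t. (\<forall>i<n. t i \<in> \<Inter> (U i)) \<and> (\<forall>i<n. \<forall>j<n. s i j = t j - t i)))"

definition rational_singularity :: "'k::field set \<Rightarrow> bool" where
  "rational_singularity R \<longleftrightarrow> (\<exists>Y. resolution R Y \<and> H1_structure_sheaf_zero Y)"


section \<open>Divisors on a regular model\<close>

definition prime_divisors :: "'k::field set set \<Rightarrow> 'k set set" where
  "prime_divisors X = {V \<in> X. has_krull_dim V 1}"

definition closed_points :: "'k::field set set \<Rightarrow> 'k set set" where
  "closed_points X = {P \<in> X. has_krull_dim P 2}"

text \<open>The normalised valuation of a discrete valuation ring \<^term>\<open>V\<close>, meaningful for \<^prop>\<open>f \<noteq> 0\<close>.\<close>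
definition vord :: "'k::field set \<Rightarrow> 'k \<Rightarrow> int" where
  "vord V f = (THE n. \<exists>t u. t \<in> V \<and> cgenideal (ring_on V) t = max_ideal V \<and>
                 u \<in> Units (ring_on V) \<and> f = u * t powi n)"

definition divisor :: "'k::field set set \<Rightarrow> ('k set \<Rightarrow> 'c::zero) \<Rightarrow> bool" where
  "divisor X D \<longleftrightarrow> finite {V. D V \<noteq> 0} \<and> {V. D V \<noteq> 0} \<subseteq> prime_divisors X"

text \<open>
  For \<^term>\<open>U\<close> open these are the sections of \<open>\<O>\<^sub>X(D)\<close> over \<^term>\<open>U\<close>; for \<open>U = {P}\<close> this is the stalk
  of \<open>\<O>\<^sub>X(D)\<close> at \<^term>\<open>P\<close>.
\<close>
definition divisorial_sheaf :: "'k::field set set \<Rightarrow> ('k set \<Rightarrow> int) \<Rightarrow> 'k set set \<Rightarrow> 'k set" where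
  "divisorial_sheaf X D U =
     {f. f = 0 \<or> (\<forall>V\<in>prime_divisors X. (\<exists>P\<in>U. P \<subseteq> V) \<longrightarrow> vord V f + D V \<ge> 0)}"

text \<open>The components of the exceptional locus: the prime divisors lying over the closed point.\<close>
definition exceptional_curves :: "'k::field set \<Rightarrow> 'k set set \<Rightarrow> 'k set set" where
  "exceptional_curves R X = {E \<in> prime_divisors X. dominates E R}"

text \<open>
  For a curve \<^term>\<open>E\<close> that is smooth at the closed point \<^term>\<open>P\<close> and \<^term>\<open>h\<close> a unit of the local
  ring \<^term>\<open>E\<close>: the order at \<^term>\<open>P\<close> of the restriction of \<^term>\<open>h\<close> to the curve.  Here \<open>y\<close>
  restricts to a uniformiser of the curve at \<^term>\<open>P\<close>.
\<close>
definition restricted_order :: "'k::field set \<Rightarrow> 'k set \<Rightarrow> 'k \<Rightarrow> int" where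
  "restricted_order E P h = (THE n. \<exists>y u. y \<in> P \<and> u \<in> Units (ring_on P) \<and>
      max_ideal P = {x + y * z | x z. x \<in> max_ideal E \<inter> P \<and> z \<in> P} \<and>
      h - u * y powi n \<in> max_ideal E)"

text \<open>
  \<open>D \<cdot> E\<close> is the degree of the line bundle \<open>\<O>\<^sub>X(D)\<close> on the smooth exceptional curve \<^term>\<open>E\<close>.  The
  function \<open>f\<close> is a rational section that does not vanish identically on \<^term>\<open>E\<close> and has no pole
  along it; with \<open>g P\<close> a local equation of \<^term>\<open>D\<close> at \<^term>\<open>P\<close>, the product \<open>f * g P\<close> is a local
  equation of \<open>D + div f\<close>.  Only finitely many summands are nonzero; they are selected
  explicitly because sums over infinite sets are zero by convention.
\<close>
definition intersection_number :: "'k::field set set \<Rightarrow> ('k set \<Rightarrow> int) \<Rightarrow> 'k set \<Rightarrow> int" where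
  "intersection_number X D E = (THE d. \<exists>f g. f \<noteq> 0 \<and> vord E f = - D E \<and>
      (\<forall>P\<in>closed_points X. P \<subseteq> E \<longrightarrow>
         divisorial_sheaf X (\<lambda>V. - D V) {P} = {z * g P | z. z \<in> P}) \<and>
      d = (\<Sum>P | P \<in> closed_points X \<and> P \<subseteq> E \<and> restricted_order E P (f * g P) \<noteq> 0.
             restricted_order E P (f * g P)))"

definition prime_divisor_fun :: "'k set \<Rightarrow> 'k set \<Rightarrow> int" where
  "prime_divisor_fun C V = (if V = C then 1 else 0)"

text \<open>The relative canonical divisor: \<open>(K + E\<^sub>j) \<cdot> E\<^sub>j = -2\<close> for every exceptional curve.\<close>
definition relative_canonical_divisor ::
  "'k::field set \<Rightarrow> 'k set set \<Rightarrow> ('k set \<Rightarrow> rat) \<Rightarrow> bool" where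
  "relative_canonical_divisor R X K \<longleftrightarrow>
     divisor X K \<and> {V. K V \<noteq> 0} \<subseteq> exceptional_curves R X \<and>
     (\<forall>E\<in>exceptional_curves R X.
        (\<Sum>C\<in>exceptional_curves R X. K C * of_int (intersection_number X (prime_divisor_fun C) E))
        + of_int (intersection_number X (prime_divisor_fun E) E) = - 2)"

text \<open>
  Simple normal crossings of a set of prime divisors: near every point, the members through
  the point are cut out by members of one regular system of parameters.  In particular every
  member is a regular curve.
\<close>
definition simple_normal_crossings :: "'k::field set set \<Rightarrow> 'k set set \<Rightarrow> bool" where
  "simple_normal_crossings X \<S> \<longleftrightarrow>
     (\<forall>P\<in>X. \<exists>xs. regular_parameters P xs \<and>
        (\<forall>V\<in>\<S>. P \<subseteq> V \<longrightarrow> (\<exists>x\<in>set xs. max_ideal V \<inter> P = cgenideal (ring_on P) x)))"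

text \<open>The residue field of \<^term>\<open>E\<close> is \<open>\<complex>(t)\<close>.\<close>
definition rational_curve :: "(complex \<Rightarrow> 'k::field) \<Rightarrow> 'k set \<Rightarrow> bool" where
  "rational_curve \<iota> E \<longleftrightarrow>
     (\<exists>t\<in>E. \<forall>x\<in>E. \<exists>p q. poly (map_poly \<iota> q) t \<notin> max_ideal E \<and>
        x * poly (map_poly \<iota> q) t - poly (map_poly \<iota> p) t \<in> max_ideal E)"

text \<open>
  The dual graph has the curves as vertices and their intersection points as edges.  It is a
  tree iff it is connected and has one edge less than vertices; the truncated subtraction
  admits the empty configuration, which occurs when the surface is smooth and not modified.
\<close>
definition tree_of_curves :: "'k::field set set \<Rightarrow> 'k set set \<Rightarrow> bool" where
  "tree_of_curves X \<E> \<longleftrightarrow>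
     finite \<E> \<and>
     (\<forall>V\<in>\<E>. \<forall>W\<in>\<E>.
        (V, W) \<in> {(C, C'). C \<in> \<E> \<and> C' \<in> \<E> \<and> (\<exists>P\<in>closed_points X. P \<subseteq> C \<and> P \<subseteq> C')}\<^sup>*) \<and>
     card {P \<in> closed_points X. \<exists>V\<in>\<E>. \<exists>W\<in>\<E>. V \<noteq> W \<and> P \<subseteq> V \<and> P \<subseteq> W} = card \<E> - 1"

text \<open>A common log-resolution of the ideals \<open>a i\<close>, with \<open>a i \<cdot> \<O>\<^sub>X = \<O>\<^sub>X(- F i)\<close>.\<close>
definition log_resolution ::
  "(complex \<Rightarrow> 'k::field) \<Rightarrow> 'k set \<Rightarrow> ('r \<Rightarrow> 'k set) \<Rightarrow> 'k set set \<Rightarrow> ('r \<Rightarrow> 'k set \<Rightarrow> int) \<Rightarrow> bool" where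
  "log_resolution \<iota> R a X F \<longleftrightarrow>
     resolution R X \<and>
     (\<forall>i. divisor X (F i) \<and> (\<forall>V. F i V \<ge> 0) \<and>
        (\<forall>P\<in>X. genideal (ring_on P) (a i) = divisorial_sheaf X (\<lambda>V. - F i V) {P})) \<and>
     simple_normal_crossings X ({V. \<exists>i. F i V \<noteq> 0} \<union> exceptional_curves R X) \<and>
     tree_of_curves X (exceptional_curves R X) \<and>
     (\<forall>E\<in>exceptional_curves R X. rational_curve \<iota> E)"

text \<open>The base \<open>Spec R\<close> is affine and local, so the direct image is given by global sections.\<close>
definition mixed_multiplier_ideal ::
  "'k::field set set \<Rightarrow> ('r::finite \<Rightarrow> 'k set \<Rightarrow> int) \<Rightarrow> ('k set \<Rightarrow> rat) \<Rightarrow> real ^ 'r \<Rightarrow> 'k set" where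
  "mixed_multiplier_ideal X F K z =
     divisorial_sheaf X (\<lambda>V. \<lceil>real_of_rat (K V) - (\<Sum>i\<in>UNIV. z $ i * of_int (F i V))\<rceil>) X"


section \<open>Regions and facets\<close>

text \<open>In the sequel \<open>J\<close> is the family of mixed multiplier ideals.\<close>

definition orthant :: "(real ^ 'r) set" where
  "orthant = {z. \<forall>i. 0 \<le> z $ i}"

definition region :: "(real ^ 'r \<Rightarrow> 'a set) \<Rightarrow> real ^ 'r \<Rightarrow> (real ^ 'r) set" where
  "region J z = {z' \<in> orthant. J z \<subseteq> J z'}"

definition constancy_region :: "(real ^ 'r \<Rightarrow> 'a set) \<Rightarrow> real ^ 'r \<Rightarrow> (real ^ 'r) set" where
  "constancy_region J z = {z' \<in> orthant. J z' = J z}"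

definition orthant_boundary :: "(real ^ 'r::finite) set \<Rightarrow> (real ^ 'r) set" where
  "orthant_boundary S = (top_of_set orthant) frontier_of S"

text \<open>
  The facets of the boundary of a region are the facets of its closure that lie in its boundary
  relative to the orthant; this excludes those in coordinate hyperplanes.
\<close>
definition supporting_hyperplanes :: "(real ^ 'r::finite) set \<Rightarrow> (real ^ 'r) set set" where
  "supporting_hyperplanes Rg =
     {affine hull \<Phi> | \<Phi>. \<Phi> facet_of closure Rg \<and> \<Phi> \<subseteq> orthant_boundary Rg}"

text \<open>
  With \<open>C\<close> a constancy region and \<open>Rg\<close> the corresponding region these are the \<open>\<C>\<close>-facets; with
  \<open>C\<close> the set computed by the algorithm they are its outer facets.
\<close>
definition facets_of_components ::
  "(real ^ 'r::finite) set \<Rightarrow> (real ^ 'r) set \<Rightarrow> (real ^ 'r) set set" where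
  "facets_of_components C Rg =
     {orthant_boundary S \<inter> H | S H. S \<in> components C \<and> H \<in> supporting_hyperplanes Rg \<and>
        (top_of_set H) interior_of (orthant_boundary S \<inter> H) \<noteq> {}}"

definition C_facets :: "(real ^ 'r::finite \<Rightarrow> 'a set) \<Rightarrow> real ^ 'r \<Rightarrow> (real ^ 'r) set set" where
  "C_facets J z = facets_of_components (constancy_region J z) (region J z)"

definition facet_interior_points ::
  "(real ^ 'r::finite) set \<Rightarrow> (real ^ 'r) set \<Rightarrow> (real ^ 'r) set" where
  "facet_interior_points Rg \<Phi> =
     {z. \<exists>H\<in>supporting_hyperplanes Rg. \<Phi> \<subseteq> H \<and> z \<in> (top_of_set H) interior_of \<Phi>}"

text \<open>The list \<open>ps\<close> consists of one interior point for each facet in \<open>\<F>\<close>, in some order.\<close>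
definition one_interior_point_each ::
  "(real ^ 'r::finite) set \<Rightarrow> (real ^ 'r) set set \<Rightarrow> (real ^ 'r) list \<Rightarrow> bool" where
  "one_interior_point_each Rg \<F> ps \<longleftrightarrow>
     (\<exists>fs pick. distinct fs \<and> set fs = \<F> \<and>
        (\<forall>\<Phi>\<in>\<F>. pick \<Phi> \<in> facet_interior_points Rg \<Phi>) \<and> ps = map pick fs)"


section \<open>The algorithm\<close>

definition move_to_front ::
  "(real ^ 'r \<Rightarrow> 'a set) \<Rightarrow> (real ^ 'r) list \<Rightarrow> (real ^ 'r) list \<Rightarrow> bool" where
  "move_to_front J N N' \<longleftrightarrow>
     (\<exists>z\<in>set N. z \<in> region J (hd N) \<and> J z \<noteq> J (hd N) \<and> N' = z # remove1 z N)"

text \<open>Step (j.1): move points to the front as long as possible.\<close>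
definition selection_step ::
  "(real ^ 'r \<Rightarrow> 'a set) \<Rightarrow> (real ^ 'r) list \<Rightarrow> (real ^ 'r) list \<Rightarrow> bool" where
  "selection_step J N N' \<longleftrightarrow> (move_to_front J)\<^sup>*\<^sup>* N N' \<and> \<not> (\<exists>N''. move_to_front J N' N'')"

text \<open>The test of step (j.2): (j.3) is performed iff no point of \<open>D\<close> has the same ideal.\<close>
definition new_ideal :: "(real ^ 'r \<Rightarrow> 'a set) \<Rightarrow> (real ^ 'r) list \<Rightarrow> real ^ 'r \<Rightarrow> bool" where
  "new_ideal J D z \<longleftrightarrow> \<not> (\<exists>\<mu>\<in>set D. J \<mu> = J z)"

text \<open>The set \<open>\<C>(j)\<close> computed at step (j.3), where \<open>lam i\<close> is the point chosen at step (i.1).\<close>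
definition computed_region ::
  "(real ^ 'r \<Rightarrow> 'a set) \<Rightarrow> (nat \<Rightarrow> real ^ 'r) \<Rightarrow> nat \<Rightarrow> (real ^ 'r) set" where
  "computed_region J lam j = region J (lam j) - (\<Union>i<j. region J (lam i))"

text \<open>
  A run of steps \<open>0, \<dots>, n - 1\<close>.  \<open>N j\<close> and \<open>D j\<close> are the lists at the beginning of step \<open>j\<close>;
  after (j.1) the list \<open>N\<close> is \<open>lam j # rest j\<close>; (j.3) turns it into \<open>lam j # rest j @ added j\<close>,
  where \<open>added j\<close> is empty if (j.3) is skipped.
\<close>
definition algorithm_run ::
  "(real ^ 'r::finite \<Rightarrow> 'a set) \<Rightarrow> nat \<Rightarrow> (nat \<Rightarrow> (real ^ 'r) list) \<Rightarrow> (nat \<Rightarrow> (real ^ 'r) list) \<Rightarrow>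
   (nat \<Rightarrow> real ^ 'r) \<Rightarrow> (nat \<Rightarrow> (real ^ 'r) list) \<Rightarrow> (nat \<Rightarrow> (real ^ 'r) list) \<Rightarrow> bool" where
  "algorithm_run J n N D lam rest added \<longleftrightarrow>
     N 0 = [0] \<and> D 0 = [] \<and>
     (\<forall>j<n. selection_step J (N j) (lam j # rest j) \<and>
        (if new_ideal J (D j) (lam j)
         then one_interior_point_each (region J (lam j))
                (facets_of_components (computed_region J lam j) (region J (lam j))) (added j)
         else added j = []) \<and>
        N (Suc j) = rest j @ added j \<and>
        D (Suc j) = D j @ [lam j])"

end

theory Submission
  imports Defs
begin

text \<open>
  The order of vanishing of \<open>f\<close> enters the multiplier ideals only through finitely many linear
  inequalities \<open>c\<^sub>V \<bullet> \<lambda> < k\<^sub>V + 1 + ord\<^sub>V f\<close> with \<open>c\<^sub>V \<ge> 0\<close>, and nothing else about them is needed.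
  A point that is added at step \<open>k\<close> lies outside all regions of the points chosen up to that step,
  which together with the selection rule (j.1) shows that \<open>\<lambda>\<^sub>j\<close> lies outside the regions of its
  predecessors.  Conversely, let \<open>\<lambda>'\<close> have an ideal strictly larger than that of \<open>\<lambda>\<^sub>j\<close> and suppose
  that it lies in no earlier region.  After a generic small enlargement of \<open>\<lambda>'\<close>, the ray from the
  origin to \<open>\<lambda>'\<close> leaves the union of the earlier regions through an interior point of an outer facet
  of some \<open>\<C>(k)\<close>.  The multiplier ideal is constant on the interior of this facet, so the point that
  was picked there is either still listed at step \<open>j\<close>, contradicting the choice of \<open>\<lambda>\<^sub>j\<close>, or was
  chosen in between, and then its region contains the exit point.
\<close>

section \<open>Down-closed polyhedra in the orthant\<close>

text \<open>A pair holds the normal and the bound of one inequality. The signs make the cell closed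
  under decreasing coordinates; strictness makes it open in the orthant. \<open>A\<close> is kept
  visible because genericity of a ray is a condition on its members.\<close>

definition lower_cell :: "((real ^ 'r::finite) \<times> real) set \<Rightarrow> (real ^ 'r) set \<Rightarrow> bool" where
  "lower_cell A Rg \<longleftrightarrow> finite A \<and> (\<forall>p\<in>A. (\<forall>i. 0 \<le> fst p $ i) \<and> 0 < snd p) \<and>
     Rg = {x \<in> orthant. \<forall>p\<in>A. fst p \<bullet> x < snd p}"

lemma closed_orthant: "closed (orthant :: (real ^ 'r::finite) set)"
proof -
  have eq: "(orthant :: (real ^ 'r) set) = (\<Inter>i. {z. 0 \<le> z $ i})"
    by (auto simp: orthant_def)
  show ?thesis unfolding eq
    by (intro closed_INT ballI closed_Collect_le) (auto intro!: continuous_intros)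
qed

lemma convex_orthant: "convex (orthant :: (real ^ 'r::finite) set)"
  by (auto simp: convex_def orthant_def)

lemma inner_mono_vec:
  fixes c x y :: "real ^ 'r::finite"
  assumes "\<forall>i. 0 \<le> c $ i" "\<forall>i. x $ i \<le> y $ i"
  shows "c \<bullet> x \<le> c \<bullet> y"
  unfolding inner_vec_def using assms by (auto intro!: sum_mono mult_left_mono)

lemma inner_nonneg_vec:
  fixes c x :: "real ^ 'r::finite"
  assumes "\<forall>i. 0 \<le> c $ i" "x \<in> orthant"
  shows "0 \<le> c \<bullet> x"
  using inner_mono_vec[of c 0 x] assms by (auto simp: orthant_def)

lemma open_halfspaces:
  fixes A :: "((real ^ 'r::finite) \<times> real) set"
  assumes "finite A"
  shows "open {x. \<forall>p\<in>A. fst p \<bullet> x < snd p}"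
proof -
  have eq: "{x. \<forall>p\<in>A. fst p \<bullet> x < snd p} = (\<Inter>p\<in>A. {x. fst p \<bullet> x < snd p})"
    by auto
  show ?thesis unfolding eq using assms by (intro open_INT ballI open_halfspace_lt) auto
qed

lemma open_strictly_above: "open {x :: real ^ 'r::finite. \<forall>i. z $ i < x $ i}"
proof -
  have eq: "{x. \<forall>i. z $ i < x $ i} = (\<Inter>i. {x. z $ i < x $ i})"
    by auto
  show ?thesis unfolding eq
    by (intro open_INT ballI open_Collect_less) (auto intro!: continuous_intros)
qed

lemma lower_cell_openin:
  assumes "lower_cell A Rg"
  shows "openin (top_of_set orthant) Rg"
proof -
  have "Rg = orthant \<inter> {x. \<forall>p\<in>A. fst p \<bullet> x < snd p}"
    using assms by (auto simp: lower_cell_def)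
  then show ?thesis
    using assms open_halfspaces[of A] by (auto simp: lower_cell_def openin_open)
qed

lemma lower_cell_convex:
  assumes "lower_cell A Rg"
  shows "convex Rg"
proof -
  have "Rg = orthant \<inter> (\<Inter>p\<in>A. {x. fst p \<bullet> x < snd p})"
    using assms by (auto simp: lower_cell_def)
  then show ?thesis
    by (auto intro!: convex_Int convex_INT convex_orthant convex_halfspace_lt)
qed

lemma lower_cell_downward:
  assumes "lower_cell A Rg" "x \<in> Rg" "y \<in> orthant" "\<forall>i. y $ i \<le> x $ i"
  shows "y \<in> Rg"
proof -
  have "fst p \<bullet> y < snd p" if "p \<in> A" for p
  proof -
    have "fst p \<bullet> y \<le> fst p \<bullet> x"
      using assms(1,4) that by (intro inner_mono_vec) (auto simp: lower_cell_def)
    also have "\<dots> < snd p"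
      using assms(1,2) that by (auto simp: lower_cell_def)
    finally show ?thesis .
  qed
  then show ?thesis
    using assms(1,3) by (auto simp: lower_cell_def)
qed

lemma lower_cell_zero: "lower_cell A Rg \<Longrightarrow> 0 \<in> Rg"
  by (auto simp: lower_cell_def orthant_def)

lemma lower_cell_scale:
  assumes "lower_cell A Rg" "x \<in> Rg" "0 \<le> s" "s \<le> 1"
  shows "s *\<^sub>R x \<in> Rg"
proof (rule lower_cell_downward[OF assms(1,2)])
  have "x \<in> orthant" using assms by (auto simp: lower_cell_def)
  then show "s *\<^sub>R x \<in> orthant" "\<forall>i. (s *\<^sub>R x) $ i \<le> x $ i"
    using assms(3,4) by (auto simp: orthant_def intro: mult_left_le_one_le)
qed

section \<open>Relative boundaries and supporting hyperplanes\<close>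

lemma orthant_boundary_iff:
  assumes "S \<subseteq> orthant"
  shows "x \<in> orthant_boundary S \<longleftrightarrow>
    x \<in> closure S \<and> \<not> (\<exists>U. openin (top_of_set orthant) U \<and> x \<in> U \<and> U \<subseteq> S)"
proof -
  \<comment> \<open>The orthant is closed, so only the interior, not the closure, depends on working
    relative to it.\<close>
  have "closure S \<subseteq> orthant"
    by (rule closure_minimal[OF assms closed_orthant])
  then have "(top_of_set orthant) closure_of S = closure S"
    using assms by (simp add: closure_of_subtopology inf.absorb2)
  then show ?thesis
    by (auto simp: orthant_boundary_def frontier_of_def interior_of_def)
qed

text \<open>A facet is the intersection of the closure with its affine hull. It lies in the relative
  boundary, which a relatively open set does not meet.\<close>

lemma lower_cell_disjoint_supporting_hyperplane:
  assumes cell: "lower_cell A Rg" and H: "H \<in> supporting_hyperplanes Rg"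
  shows "H \<inter> Rg = {}"
proof -
  obtain \<Phi> where \<Phi>: "H = affine hull \<Phi>" "\<Phi> facet_of closure Rg" "\<Phi> \<subseteq> orthant_boundary Rg"
    using H by (auto simp: supporting_hyperplanes_def)
  have "\<Phi> = H \<inter> closure Rg"
    using \<Phi>(1,2) lower_cell_convex[OF cell] 
    by (metis convex_closure face_of_imp_eq_affine_Int facet_of_def)
  moreover have "orthant_boundary Rg \<inter> Rg = {}"
    using lower_cell_openin[OF cell] by (auto simp: orthant_boundary_def frontier_of_def interior_of_openin)
  ultimately show ?thesis
    using \<Phi>(3) closure_subset[of Rg] by blast
qed

text \<open>Near \<open>x\<close> the cell is one side of the hyperplane, so its closure contains a
  relatively open piece of the hyperplane. The face cut out there thus spans the hyperplane and has
  codimension one; \<open>le\<close> makes it a face and keeps it off the cell.\<close>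

lemma supporting_hyperplaneI:
  fixes Rg :: "(real ^ 'r::finite) set"
  assumes cell: "lower_cell A Rg" and "c \<noteq> 0" "open B" "x \<in> B" "c \<bullet> x = b"
    and local_form: "\<And>y. y \<in> B \<Longrightarrow> y \<in> Rg \<longleftrightarrow> c \<bullet> y < b"
    and le: "\<And>y. y \<in> Rg \<Longrightarrow> c \<bullet> y < b"
    and near: "\<And>y. y \<in> B \<Longrightarrow> c \<bullet> y = b \<Longrightarrow> y \<in> closure {z \<in> B. c \<bullet> z < b}"
  shows "{y. c \<bullet> y = b} \<in> supporting_hyperplanes Rg"
proof -
  define \<Phi> where "\<Phi> = closure Rg \<inter> {y. c \<bullet> y = b}"
  have le': "c \<bullet> y \<le> b" if "y \<in> closure Rg" for y
  proof -
    have "closure Rg \<subseteq> {y. c \<bullet> y \<le> b}"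
      by (rule closure_minimal) (use le in \<open>force simp: closed_halfspace_le\<close>)+
    then show ?thesis using that by auto
  qed
  have half: "{z \<in> B. c \<bullet> z < b} \<subseteq> Rg" using local_form by auto
  have sub: "{y. c \<bullet> y = b} \<inter> B \<subseteq> \<Phi>"
    using near closure_mono[OF half] by (auto simp: \<Phi>_def)
  have aff: "affine {y. c \<bullet> y = b}" by (rule affine_hyperplane)
  have hull: "affine hull \<Phi> = {y. c \<bullet> y = b}"
  proof
    show "affine hull \<Phi> \<subseteq> {y. c \<bullet> y = b}"
      by (rule hull_minimal) (auto simp: \<Phi>_def aff)
    have eq: "affine hull ({y. c \<bullet> y = b} \<inter> B) = {y. c \<bullet> y = b}"
    proof (subst affine_hull_affine_Int_open[OF aff \<open>open B\<close>])
      show "{y. c \<bullet> y = b} \<inter> B \<noteq> {}" using assms(4,5) by blast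
    
      show "affine hull {y. c \<bullet> y = b} = {y. c \<bullet> y = b}" using aff by (rule hull_same)
    qed
    show "{y. c \<bullet> y = b} \<subseteq> affine hull \<Phi>"
      using hull_mono[OF sub, of affine] unfolding eq .
  qed
  have face: "\<Phi> face_of closure Rg"
    unfolding \<Phi>_def
    by (rule face_of_Int_supporting_hyperplane_le)
       (auto intro: convex_closure lower_cell_convex[OF cell] le')
  have ne: "{z \<in> B. c \<bullet> z < b} \<noteq> {}"
  proof
    assume empty: "{z \<in> B. c \<bullet> z < b} = {}"
    show False using near[OF assms(4,5)] unfolding empty by simp
  qed
  have "open {z \<in> B. c \<bullet> z < b}"
  proof -
    have "{z \<in> B. c \<bullet> z < b} = B \<inter> {z. c \<bullet> z < b}" by auto
    then show ?thesis using open_Int[OF \<open>open B\<close> open_halfspace_lt] by simp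
  qed
  then have "interior (closure Rg) \<noteq> {}"
    using interior_maximal[OF subset_trans[OF half closure_subset]] ne by blast
  then have "aff_dim (closure Rg) = DIM(real ^ 'r)"
    by (rule aff_dim_nonempty_interior)
  moreover have "aff_dim \<Phi> = DIM(real ^ 'r) - 1"
    using aff_dim_hyperplane[OF \<open>c \<noteq> 0\<close>, of b] unfolding hull[symmetric] by simp
  ultimately have "\<Phi> facet_of closure Rg"
    using face sub assms(4,5) by (auto simp: facet_of_def)
  moreover have "\<Phi> \<subseteq> orthant_boundary Rg"
  proof -
    have "Rg \<subseteq> orthant" using cell by (auto simp: lower_cell_def)
    then show ?thesis
      unfolding \<Phi>_def using le by (auto simp: orthant_boundary_iff) (metis less_irrefl subsetD)
  qed
  ultimately show ?thesis
    using hull by (auto simp: supporting_hyperplanes_def)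
qed

section \<open>Exit of a generic ray from a union of cells\<close>

lemma generic_point:
  fixes U :: "(real ^ 'r::finite) set"
  assumes "open U" "U \<noteq> {}" "finite E" "0 \<notin> E"
  obtains y where "y \<in> U" "\<forall>d\<in>E. d \<bullet> y \<noteq> 0"
proof -
  have "negligible (\<Union>d\<in>E. {y. d \<bullet> y = 0})"
    using assms(3,4) by (intro negligible_Union) (auto intro!: negligible_hyperplane)
  then have "\<not> U \<subseteq> (\<Union>d\<in>E. {y. d \<bullet> y = 0})"
    using assms(1,2) open_not_negligible negligible_subset by blast
  then show ?thesis using that by auto
qed

text \<open>A cell meets the ray in an initial interval, and there are finitely many cells, so one
  of them reaches as far as their union. Taking \<open>k\<close> least gives the last conclusion:
  every cell before \<open>k\<close> has been left strictly before the exit time.\<close>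

lemma ray_exit:
  fixes y :: "real ^ 'r::finite" and j :: nat
  assumes cells: "\<And>i. i < j \<Longrightarrow> lower_cell (A i) (Rg i)"
    and "0 < j" "y \<in> orthant" "\<And>i. i < j \<Longrightarrow> y \<notin> Rg i"
  obtains t k where "0 < t" "t \<le> 1" "k < j"
    "\<And>s. 0 \<le> s \<Longrightarrow> s < t \<Longrightarrow> s *\<^sub>R y \<in> Rg k"
    "\<And>i. i < j \<Longrightarrow> t *\<^sub>R y \<notin> Rg i"
    "\<And>i. i < k \<Longrightarrow> \<exists>s. 0 \<le> s \<and> s < t \<and> s *\<^sub>R y \<notin> Rg i"
proof -
  have ray: "s *\<^sub>R y \<in> orthant" if "0 \<le> s" for s
    using that \<open>y \<in> orthant\<close> by (auto simp: orthant_def)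
  have down: "s *\<^sub>R y \<in> Rg i" if "i < j" "s' *\<^sub>R y \<in> Rg i" "0 \<le> s" "s \<le> s'" for i s s'
  proof (cases "s' = 0")
    case False
    have "(s / s') *\<^sub>R (s' *\<^sub>R y) \<in> Rg i"
      by (rule lower_cell_scale[OF cells[OF that(1)] that(2)]) (use that False in auto)
    then show ?thesis using False by simp
  qed (use that in auto)
  define T where "T = {s. 0 \<le> s \<and> (\<exists>i<j. s *\<^sub>R y \<in> Rg i)}"
  have "0 \<in> T"
    using lower_cell_zero[OF cells[OF \<open>0 < j\<close>]] \<open>0 < j\<close> by (auto simp: T_def)
  have T_le: "s \<le> 1" if "s \<in> T" for s
    using down[of _ s 1] that assms(4) by (force simp: T_def)
  have bdd: "bdd_above T" using T_le by (rule bdd_aboveI)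
  define t where "t = Sup T"
  \<comment> \<open>Cells are open along the ray, so membership at \<open>t\<close> would persist a
    little beyond the supremum.\<close>
  have "t \<notin> T"
  proof
    assume "t \<in> T"
    then obtain i where i: "i < j" "t *\<^sub>R y \<in> Rg i" "0 \<le> t" by (auto simp: T_def)
    have cell: "lower_cell (A i) (Rg i)" using cells i by auto
    let ?U = "{x. \<forall>p\<in>A i. fst p \<bullet> x < snd p}"
    have "open ((\<lambda>s. s *\<^sub>R y) -` ?U)"
      using cell by (intro open_vimage open_halfspaces continuous_intros) (auto simp: lower_cell_def)
    moreover have "t \<in> (\<lambda>s. s *\<^sub>R y) -` ?U"
      using i cell by (auto simp: lower_cell_def)
    ultimately obtain e where e: "e > 0" "ball t e \<subseteq> (\<lambda>s. s *\<^sub>R y) -` ?U"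
      using openE by blast
    then have "(t + e/2) *\<^sub>R y \<in> ?U"
      by (force simp: dist_real_def)
    then have "(t + e/2) *\<^sub>R y \<in> Rg i"
      using cell ray[of "t + e/2"] i e(1) by (auto simp: lower_cell_def)
    then have "t + e/2 \<in> T" using i e(1) by (auto simp: T_def)
    then have "t + e/2 \<le> t" unfolding t_def by (rule cSup_upper[OF _ bdd])
    then show False using e(1) by simp
  qed
  have "0 \<le> t" unfolding t_def by (rule cSup_upper[OF \<open>0 \<in> T\<close> bdd])
  then have "0 < t" using \<open>t \<notin> T\<close> \<open>0 \<in> T\<close> by (cases "t = 0") auto
  have "t \<le> 1" unfolding t_def using \<open>0 \<in> T\<close> T_le by (intro cSup_least) auto
  have below: "\<exists>i<j. s *\<^sub>R y \<in> Rg i" if "0 \<le> s" "s < t" for s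
  proof -
    have "\<exists>s'\<in>T. s < s'"
      using less_cSup_iff[OF _ bdd, of s] that(2) \<open>0 \<in> T\<close> unfolding t_def by blast
    then obtain s' where "s' \<in> T" "s < s'" by blast
    then show ?thesis using down[of _ s' s] that by (auto simp: T_def)
  qed
  let ?P = "\<lambda>k. k < j \<and> (\<forall>s. 0 \<le> s \<longrightarrow> s < t \<longrightarrow> s *\<^sub>R y \<in> Rg k)"
  have "\<exists>k. ?P k"
  proof (rule ccontr)
    assume "\<nexists>k. ?P k"
    then have "\<forall>k. \<exists>s. k < j \<longrightarrow> 0 \<le> s \<and> s < t \<and> s *\<^sub>R y \<notin> Rg k" by blast
    then obtain f where f: "\<And>k. k < j \<Longrightarrow> 0 \<le> f k \<and> f k < t \<and> f k *\<^sub>R y \<notin> Rg k" by metis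
    \<comment> \<open>If every cell were left before \<open>t\<close>, then by down-closedness all
      would be left at the latest of the times \<open>f k\<close>, against
      \<open>below\<close>.\<close>
    define s where "s = Max (f ` {..<j})"
    have "s \<in> f ` {..<j}" unfolding s_def using \<open>0 < j\<close> by (intro Max_in) auto
    then obtain i where i: "i < j" "s *\<^sub>R y \<in> Rg i" using f below by blast
    have "f i \<le> s" unfolding s_def using i by (intro Max_ge) auto
    then show False using f[OF i(1)] down[OF i] by blast
  qed
  then have "?P (LEAST k. ?P k)" by (rule LeastI_ex)
  moreover have "\<exists>s. 0 \<le> s \<and> s < t \<and> s *\<^sub>R y \<notin> Rg i" if "i < (LEAST k. ?P k)" for i
    using not_less_Least[OF that] that calculation by auto
  moreover have "t *\<^sub>R y \<notin> Rg i" if "i < j" for i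
    using \<open>t \<notin> T\<close> \<open>0 \<le> t\<close> that by (auto simp: T_def)
  ultimately show thesis
    using that[of t "LEAST k. ?P k"] \<open>0 < t\<close> \<open>t \<le> 1\<close> by blast
qed

text \<open>If two inequalities are equalities at the same point of the ray, the vector in
  \<open>generic\<close> is orthogonal to \<open>y\<close>, hence zero, and both cut out the same
  half-space. So the cell looks like one half-space near the exit point, which is therefore interior
  to a facet.\<close>

lemma generic_ray_exits_through_facet:
  fixes y :: "real ^ 'r::finite" and j :: nat
  assumes cells: "\<And>i. i < j \<Longrightarrow> lower_cell (A i) (Rg i)"
    and "0 < j" and ypos: "\<And>i. 0 < y $ i" and "\<And>i. i < j \<Longrightarrow> y \<notin> Rg i"
    and generic: "\<And>i p q. i < j \<Longrightarrow> p \<in> A i \<Longrightarrow> q \<in> A i \<Longrightarrow>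
      snd q *\<^sub>R fst p \<noteq> snd p *\<^sub>R fst q \<Longrightarrow> (snd q *\<^sub>R fst p - snd p *\<^sub>R fst q) \<bullet> y \<noteq> 0"
  obtains t k S H where "0 < t" "t \<le> 1" "k < j" "\<And>i. i < k \<Longrightarrow> Rg i \<noteq> Rg k"
    "\<And>i. i < j \<Longrightarrow> t *\<^sub>R y \<notin> Rg i"
    "S \<in> components (Rg k - (\<Union>i<k. Rg i))" "H \<in> supporting_hyperplanes (Rg k)"
    "t *\<^sub>R y \<in> (top_of_set H) interior_of (orthant_boundary S \<inter> H)"
proof -
  have "y \<in> orthant" using less_imp_le[OF ypos] by (simp add: orthant_def)
  obtain t k where t: "0 < t" "t \<le> 1" "k < j"
    and below: "\<And>s. 0 \<le> s \<Longrightarrow> s < t \<Longrightarrow> s *\<^sub>R y \<in> Rg k"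
    and outside: "\<And>i. i < j \<Longrightarrow> t *\<^sub>R y \<notin> Rg i"
    and earlier: "\<And>i. i < k \<Longrightarrow> \<exists>s. 0 \<le> s \<and> s < t \<and> s *\<^sub>R y \<notin> Rg i"
    by (rule ray_exit[OF cells \<open>0 < j\<close> \<open>y \<in> orthant\<close> assms(4)]) blast+
  define \<mu> where "\<mu> = t *\<^sub>R y"
  have cell: "lower_cell (A k) (Rg k)" using cells t by auto
  then have fin: "finite (A k)" by (auto simp: lower_cell_def)
  have bpos: "0 < snd q" if "q \<in> A k" for q using cell that by (auto simp: lower_cell_def)
  have \<mu>pos: "0 < \<mu> $ i" for i using ypos t by (auto simp: \<mu>_def)
  have \<mu>_le: "fst q \<bullet> \<mu> \<le> snd q" if q: "q \<in> A k" for q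
  proof (rule ccontr)
    assume "\<not> fst q \<bullet> \<mu> \<le> snd q"
    then have gt: "snd q < t * (fst q \<bullet> y)" by (simp add: \<mu>_def)
    then have pos: "0 < fst q \<bullet> y"
      using bpos[OF q] t(1) by (smt (verit) zero_less_mult_iff)
    \<comment> \<open>The time at which the ray meets the hyperplane of \<open>q\<close>. It would
      precede \<open>t\<close>, when the ray is still inside the open half-space.\<close>
    let ?s = "snd q / (fst q \<bullet> y)"
    have "?s *\<^sub>R y \<in> Rg k"
      using bpos[OF q] pos gt by (intro below) (auto simp: field_simps)
    then have "fst q \<bullet> (?s *\<^sub>R y) < snd q" using cell q unfolding lower_cell_def by blast
    then show False using pos by simp
  qed
  have "\<mu> \<in> orthant" using less_imp_le[OF \<mu>pos] by (simp add: orthant_def)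
  moreover have "\<mu> \<notin> Rg k" using outside t(3) by (auto simp: \<mu>_def)
  ultimately obtain p where p: "p \<in> A k" "\<not> fst p \<bullet> \<mu> < snd p"
    using cell by (auto simp: lower_cell_def)
  define c where "c = fst p"
  define b where "b = snd p"
  have "0 < b" using bpos[OF p(1)] by (simp add: b_def)
  have c\<mu>: "c \<bullet> \<mu> = b" using p \<mu>_le[OF p(1)] by (simp add: c_def b_def)
  then have "c \<noteq> 0" using \<open>0 < b\<close> by auto
  have tight: "fst q \<bullet> x < snd q \<longleftrightarrow> c \<bullet> x < b" if q: "q \<in> A k" "fst q \<bullet> \<mu> = snd q" for q x
  proof -
    have "(snd q *\<^sub>R c - b *\<^sub>R fst q) \<bullet> \<mu> = 0"
      using c\<mu> q(2) by (simp add: inner_diff_left)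
    then have "(snd q *\<^sub>R c - b *\<^sub>R fst q) \<bullet> y = 0"
      using t(1) by (simp add: \<mu>_def)
    then have eq: "snd q *\<^sub>R c = b *\<^sub>R fst q"
      using generic[OF t(3) p(1) q(1)] by (auto simp: c_def b_def)
    have "snd q * (c \<bullet> x) = b * (fst q \<bullet> x)"
      using arg_cong[OF eq, of "\<lambda>v. v \<bullet> x"] by simp
    moreover have "c \<bullet> x < b \<longleftrightarrow> snd q * (c \<bullet> x) < snd q * b"
      using bpos[OF q(1)] by simp
    moreover have "fst q \<bullet> x < snd q \<longleftrightarrow> b * (fst q \<bullet> x) < b * snd q"
      using \<open>0 < b\<close> by simp
    ultimately show ?thesis by (simp add: mult.commute)
  qed
  \<comment> \<open>Some inequality of cell \<open>i\<close> fails already before time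
    \<open>t\<close>. Its form grows strictly along the ray, so at \<open>\<mu>\<close> it is
    violated strictly, which is an open condition.\<close>
  have "\<exists>q\<in>A i. snd q < fst q \<bullet> \<mu>" if i: "i < k" for i
  proof -
    obtain s where s: "0 \<le> s" "s < t" "s *\<^sub>R y \<notin> Rg i" using earlier[OF i] by blast
    have cell_i: "lower_cell (A i) (Rg i)" using cells i t(3) by auto
    have "s *\<^sub>R y \<in> orthant" using s(1) \<open>y \<in> orthant\<close> by (auto simp: orthant_def)
    then obtain q where q: "q \<in> A i" "snd q \<le> s * (fst q \<bullet> y)"
      using s(3) cell_i by (fastforce simp: lower_cell_def)
    have "0 < snd q" using q(1) cell_i by (auto simp: lower_cell_def)
    then have "0 < fst q \<bullet> y"
      using q(2) s(1) by (smt (verit) mult_nonneg_nonpos)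
    then have "s * (fst q \<bullet> y) < t * (fst q \<bullet> y)" using s(2) by simp
    then have "snd q < fst q \<bullet> \<mu>" using q(2) by (simp add: \<mu>_def)
    then show ?thesis using q(1) by blast
  qed
  then obtain g where g: "\<And>i. i < k \<Longrightarrow> g i \<in> A i \<and> snd (g i) < fst (g i) \<bullet> \<mu>" by metis
  \<comment> \<open>Conditions that hold at \<open>\<mu>\<close> and persist nearby: all coordinates
    are positive, the non-tight inequalities of cell \<open>k\<close> hold, and every earlier cell
    is avoided.\<close>
  define V where "V = {x. \<forall>i. 0 $ i < x $ i} \<inter>
     {x. \<forall>q\<in>{q \<in> A k. fst q \<bullet> \<mu> \<noteq> snd q}. fst q \<bullet> x < snd q} \<inter>
     (\<Inter>i\<in>{..<k}. {x. fst (g i) \<bullet> x > snd (g i)})"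
  have "open V"
    unfolding V_def using fin
    by (intro open_Int open_INT ballI open_halfspaces open_strictly_above) (simp_all add: open_halfspace_gt)
  moreover have "\<mu> \<in> V"
    using \<mu>pos \<mu>_le g by (force simp: V_def)
  ultimately obtain e where e: "e > 0" "ball \<mu> e \<subseteq> V" using openE by blast
  define B where "B = ball \<mu> e"
  have "open B" "\<mu> \<in> B" "convex B" using e by (auto simp: B_def)
  have local_form: "x \<in> Rg k \<longleftrightarrow> c \<bullet> x < b" if "x \<in> B" for x
  proof -
    have xV: "x \<in> V" using that e by (auto simp: B_def)
    then have "x \<in> orthant" by (auto simp: V_def orthant_def less_imp_le)
    then have "x \<in> Rg k \<longleftrightarrow> (\<forall>q\<in>A k. fst q \<bullet> x < snd q)"
      using cell by (auto simp: lower_cell_def)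
    also have "\<dots> \<longleftrightarrow> c \<bullet> x < b"
    proof
      assume "\<forall>q\<in>A k. fst q \<bullet> x < snd q"
      then show "c \<bullet> x < b" using p(1) by (auto simp: c_def b_def)
    next
      assume less: "c \<bullet> x < b"
      show "\<forall>q\<in>A k. fst q \<bullet> x < snd q"
      proof
        fix q assume "q \<in> A k"
        then show "fst q \<bullet> x < snd q"
          using tight[of q x] less xV by (cases "fst q \<bullet> \<mu> = snd q") (auto simp: V_def)
      qed
    qed
    finally show ?thesis .
  qed
  have avoid: "x \<notin> Rg i" if "x \<in> B" "i < k" for x i
  proof -
    have "snd (g i) < fst (g i) \<bullet> x" using that e by (auto simp: B_def V_def)
    then show ?thesis
      using g[OF that(2)] cells[of i] that(2) t(3) by (fastforce simp: lower_cell_def)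
  qed
  have half_eq: "B \<inter> {z. c \<bullet> z < b} = {z \<in> B. c \<bullet> z < b}" by auto
  have near: "x \<in> closure {z \<in> B. c \<bullet> z < b}" if "x \<in> B" "c \<bullet> x = b" for x
  proof -
    have "x \<in> B \<inter> closure {z. c \<bullet> z < b}"
      using that \<open>c \<noteq> 0\<close> by (simp add: closure_halfspace_lt)
    then have "x \<in> closure (B \<inter> {z. c \<bullet> z < b})"
      using open_Int_closure_subset[OF \<open>open B\<close>] by blast
    then show ?thesis unfolding half_eq .
  qed
  define H where "H = {x. c \<bullet> x = b}"
  have "H \<in> supporting_hyperplanes (Rg k)"
    unfolding H_def
    by (rule supporting_hyperplaneI[OF cell \<open>c \<noteq> 0\<close> \<open>open B\<close> \<open>\<mu> \<in> B\<close> c\<mu> local_form _ near])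
       (use cell p(1) in \<open>auto simp: lower_cell_def c_def b_def\<close>)
  define C where "C = Rg k - (\<Union>i<k. Rg i)"
  have half: "{z \<in> B. c \<bullet> z < b} \<subseteq> C" using local_form avoid by (auto simp: C_def)
  have "{z \<in> B. c \<bullet> z < b} \<noteq> {}"
  proof
    assume empty: "{z \<in> B. c \<bullet> z < b} = {}"
    show False using near[OF \<open>\<mu> \<in> B\<close> c\<mu>] unfolding empty by simp
  qed
  then have "C \<noteq> {}" using half by auto
  \<comment> \<open>The half-ball is convex, so it lies in a single component \<open>S\<close>. Its
    flat side \<open>H \<inter> B\<close> is the neighbourhood of \<open>\<mu>\<close> in
    \<open>H\<close> that belongs to the boundary of \<open>S\<close>.\<close>
  have "connected {z \<in> B. c \<bullet> z < b}"
    using convex_connected[OF convex_Int[OF \<open>convex B\<close> convex_halfspace_lt[of c b]]] unfolding half_eq .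
  then obtain S where S: "S \<in> components C" "{z \<in> B. c \<bullet> z < b} \<subseteq> S"
    using exists_component_superset[OF half \<open>C \<noteq> {}\<close>] by blast
  have "S \<subseteq> C" using S(1) by (rule in_components_subset)
  then have "S \<subseteq> Rg k" "S \<subseteq> orthant" using cell by (auto simp: C_def lower_cell_def)
  have "x \<in> orthant_boundary S" if "x \<in> B" "x \<in> H" for x
    using near[OF that(1)] that closure_mono[OF S(2)] \<open>S \<subseteq> Rg k\<close> local_form[OF that(1)]
    unfolding orthant_boundary_iff[OF \<open>S \<subseteq> orthant\<close>] H_def by auto
  then have "H \<inter> B \<subseteq> orthant_boundary S \<inter> H" by auto
  moreover have "openin (top_of_set H) (H \<inter> B)" using \<open>open B\<close> by (simp add: openin_open_Int)
  ultimately have "H \<inter> B \<subseteq> (top_of_set H) interior_of (orthant_boundary S \<inter> H)"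
    by (rule interior_of_maximal)
  moreover have "\<mu> \<in> H \<inter> B" using \<open>\<mu> \<in> B\<close> c\<mu> by (simp add: H_def)
  ultimately have "\<mu> \<in> (top_of_set H) interior_of (orthant_boundary S \<inter> H)" by blast
  moreover have "Rg i \<noteq> Rg k" if "i < k" for i
    using earlier[OF that] below by auto
  ultimately show thesis
    using that[of t k S H] t outside S(1) \<open>H \<in> supporting_hyperplanes (Rg k)\<close>
    by (simp add: \<mu>_def C_def)
qed

text \<open>Moving \<open>z\<close> slightly up in all coordinates keeps it out of the down-closed
  cells and leaves room to make the ray generic.\<close>

lemma exit_through_facet:
  fixes z :: "real ^ 'r::finite" and j :: nat
  assumes cells: "\<And>i. i < j \<Longrightarrow> lower_cell (A i) (Rg i)"
    and "0 < j" "z \<in> orthant" "\<And>i. i < j \<Longrightarrow> z \<notin> Rg i" "open U" "z \<in> U"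
  obtains y t k S H where "y \<in> U" "y \<in> orthant" "0 < t" "t \<le> 1" "k < j"
    "\<And>i. i < k \<Longrightarrow> Rg i \<noteq> Rg k" "\<And>i. i < j \<Longrightarrow> t *\<^sub>R y \<notin> Rg i"
    "S \<in> components (Rg k - (\<Union>i<k. Rg i))" "H \<in> supporting_hyperplanes (Rg k)"
    "t *\<^sub>R y \<in> (top_of_set H) interior_of (orthant_boundary S \<inter> H)"
proof -
  \<comment> \<open>Zero is removed because proportional inequalities impose no condition on the
    ray.\<close>
  define E where "E = (\<Union>i<j. (\<lambda>(p, q). snd q *\<^sub>R fst p - snd p *\<^sub>R fst q) ` (A i \<times> A i)) - {0}"
  have "finite (A i)" if "i < j" for i using cells[OF that] by (simp add: lower_cell_def)
  then have "finite E"
    unfolding E_def by (intro finite_Diff finite_UN_I finite_imageI finite_cartesian_product) auto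
  have "0 \<notin> E" by (simp add: E_def)
  define U' where "U' = U \<inter> {x. \<forall>i. z $ i < x $ i}"
  have "open U'"
    unfolding U'_def by (rule open_Int[OF \<open>open U\<close> open_strictly_above])
  moreover have "U' \<noteq> {}"
  proof -
    \<comment> \<open>Here \<open>1\<close> is the all-ones vector; a short step along it increases
      every coordinate.\<close>
    have "open ((\<lambda>d. z + d *\<^sub>R 1) -` U)"
      using \<open>open U\<close> by (intro open_vimage continuous_intros)
    moreover have "(0::real) \<in> (\<lambda>d. z + d *\<^sub>R 1) -` U" using \<open>z \<in> U\<close> by simp
    ultimately obtain e where e: "e > 0" "ball 0 e \<subseteq> (\<lambda>d. z + d *\<^sub>R 1) -` U"
      using openE by blast
    then have "z + (e/2) *\<^sub>R 1 \<in> U" by (force simp: dist_real_def)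
    then have "z + (e/2) *\<^sub>R 1 \<in> U'" using e(1) by (auto simp: U'_def)
    then show ?thesis by blast
  qed
  ultimately obtain y where y: "y \<in> U'" "\<forall>d\<in>E. d \<bullet> y \<noteq> 0"
    using generic_point \<open>finite E\<close> \<open>0 \<notin> E\<close> by metis
  have zy: "z $ i < y $ i" for i using y(1) by (auto simp: U'_def)
  have ypos: "0 < y $ i" for i
    using zy[of i] \<open>z \<in> orthant\<close> unfolding orthant_def by (auto intro: le_less_trans)
  have "y \<in> orthant" using less_imp_le[OF ypos] by (simp add: orthant_def)
  have notin: "y \<notin> Rg i" if "i < j" for i
    using lower_cell_downward[OF cells[OF that] _ \<open>z \<in> orthant\<close>] assms(4)[OF that] less_imp_le[OF zy]
    by blast
  have generic: "(snd q *\<^sub>R fst p - snd p *\<^sub>R fst q) \<bullet> y \<noteq> 0"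
    if "i < j" "p \<in> A i" "q \<in> A i" "snd q *\<^sub>R fst p \<noteq> snd p *\<^sub>R fst q" for i p q
  proof -
    have "snd q *\<^sub>R fst p - snd p *\<^sub>R fst q \<in> E" using that by (force simp: E_def)
    then show ?thesis using y(2) by blast
  qed
  have "y \<in> U" using y(1) by (simp add: U'_def)
  show thesis
    by (rule generic_ray_exits_through_facet[OF cells \<open>0 < j\<close> ypos notin generic])
       (assumption | rule that[OF \<open>y \<in> U\<close> \<open>y \<in> orthant\<close>])+
qed

section \<open>Ideals given by linear thresholds\<close>

text \<open>In the application \<open>B\<close> is the finite set of prime divisors occurring in
  some \<open>F i\<close>, \<open>G\<close> collects the order conditions along all others, which do
  not involve \<open>x\<close>, and \<open>Z\<close> is \<open>{0}\<close>, where the order has no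
  meaning.\<close>

locale threshold_family =
  fixes J :: "real ^ 'r::finite \<Rightarrow> 'a set" and Z G :: "'a set"
    and B :: "'w set" and c :: "'w \<Rightarrow> real ^ 'r" and \<kappa> :: "'w \<Rightarrow> real" and v :: "'w \<Rightarrow> 'a \<Rightarrow> int"
  assumes J_eq: "J x = Z \<union> {f \<in> G. \<forall>w\<in>B. c w \<bullet> x < \<kappa> w + of_int (v w f)}"
    and finite_B: "finite B"
    and c_nonneg: "w \<in> B \<Longrightarrow> 0 \<le> c w $ i"
begin

lemma J_antimono:
  assumes "\<forall>i. x $ i \<le> y $ i"
  shows "J y \<subseteq> J x"
proof -
  have "c w \<bullet> x < \<kappa> w + of_int (v w f)"
    if "w \<in> B" "c w \<bullet> y < \<kappa> w + of_int (v w f)" for w f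
    using inner_mono_vec[of "c w" x y] c_nonneg that assms by (force intro: le_less_trans)
  then show ?thesis by (auto simp: J_eq)
qed

text \<open>
  Although \<^term>\<open>J z\<close> may be infinite, only finitely many inequalities are needed, since the
  integers \<^term>\<open>v w f\<close> are bounded below on it.
\<close>
lemma region_lower_cell:
  assumes z: "z \<in> orthant"
  shows "\<exists>A. lower_cell A (region J z)"
proof (cases "J z \<subseteq> Z")
  case True
  then have "lower_cell {} (region J z)"
    by (auto simp: lower_cell_def region_def J_eq)
  then show ?thesis ..
next
  case False
  have above: "c w \<bullet> z < \<kappa> w + of_int (v w f)" if "w \<in> B" "f \<in> J z - Z" for w f
    using that by (auto simp: J_eq)
  have "\<exists>f. f \<in> J z - Z \<and> (\<forall>g. g \<in> J z - Z \<longrightarrow> v w f \<le> v w g)" if w: "w \<in> B" for w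
  proof -
    obtain f0 where "f0 \<in> J z - Z" using False by blast
    \<comment> \<open>Orders on \<open>J z - Z\<close> exceed
      \<open>c w \<bullet> z - \<kappa> w\<close>, so subtracting its floor makes them natural
      numbers without truncation, and a least one exists.\<close>
    then obtain f where f: "f \<in> J z - Z"
      "\<And>g. g \<in> J z - Z \<Longrightarrow> nat (v w f - \<lfloor>c w \<bullet> z - \<kappa> w\<rfloor>) \<le> nat (v w g - \<lfloor>c w \<bullet> z - \<kappa> w\<rfloor>)"
      using ex_has_least_nat[of "\<lambda>f. f \<in> J z - Z" f0 "\<lambda>f. nat (v w f - \<lfloor>c w \<bullet> z - \<kappa> w\<rfloor>)"] by blast
    have "v w f \<le> v w g" if "g \<in> J z - Z" for g
    proof -
      have "\<lfloor>c w \<bullet> z - \<kappa> w\<rfloor> \<le> v w g"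
        using above[OF w that] by linarith
      then show ?thesis using f(2)[OF that] by linarith
    qed
    then show ?thesis using f(1) by blast
  qed
  then obtain h where h: "\<And>w. w \<in> B \<Longrightarrow> h w \<in> J z - Z"
    "\<And>w g. w \<in> B \<Longrightarrow> g \<in> J z - Z \<Longrightarrow> v w (h w) \<le> v w g"
    by metis
  \<comment> \<open>The sharpest bound along \<open>w\<close>, given by an element of least order
    there; different \<open>w\<close> may use different elements.\<close>
  define b where "b w = \<kappa> w + of_int (v w (h w))" for w
  have "lower_cell ((\<lambda>w. (c w, b w)) ` B) (region J z)"
    unfolding lower_cell_def
  proof (intro conjI ballI allI)
    show "finite ((\<lambda>w. (c w, b w)) ` B)" using finite_B by simp
  next
    fix p i assume "p \<in> (\<lambda>w. (c w, b w)) ` B"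
    then show "0 \<le> fst p $ i" using c_nonneg by auto
  next
    fix p assume "p \<in> (\<lambda>w. (c w, b w)) ` B"
    then obtain w where w: "w \<in> B" "p = (c w, b w)" by blast
    have "0 \<le> c w \<bullet> z" using inner_nonneg_vec[of "c w" z] c_nonneg w(1) z by auto
    also have "\<dots> < b w" using above[OF w(1) h(1)[OF w(1)]] by (simp add: b_def)
    finally show "0 < snd p" using w(2) by simp
  next
    have "J z \<subseteq> J x \<longleftrightarrow> (\<forall>w\<in>B. c w \<bullet> x < b w)" for x
    proof
      assume sub: "J z \<subseteq> J x"
      show "\<forall>w\<in>B. c w \<bullet> x < b w"
      proof
        fix w assume w: "w \<in> B"
        have "h w \<in> J x" "h w \<notin> Z" using h(1)[OF w] sub by auto
        then show "c w \<bullet> x < b w" using w by (auto simp: J_eq b_def)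
      qed
    next
      assume less: "\<forall>w\<in>B. c w \<bullet> x < b w"
      show "J z \<subseteq> J x"
      proof
        fix f assume f: "f \<in> J z"
        show "f \<in> J x"
        proof (cases "f \<in> Z")
          case False
          have "c w \<bullet> x < \<kappa> w + of_int (v w f)" if w: "w \<in> B" for w
          proof -
            have "b w \<le> \<kappa> w + of_int (v w f)" using h(2)[OF w] f False by (simp add: b_def)
            then show ?thesis using less w by force
          qed
          then show ?thesis using f False by (auto simp: J_eq)
        qed (simp add: J_eq)
      qed
    qed
    then show "region J z = {x \<in> orthant. \<forall>p\<in>(\<lambda>w. (c w, b w)) ` B. fst p \<bullet> x < snd p}"
      by (auto simp: region_def)
  qed
  then show ?thesis ..
qed

section \<open>Semicontinuity of the ideals and their behaviour on facets\<close>

lemma openin_region: "z \<in> orthant \<Longrightarrow> openin (top_of_set orthant) (region J z)"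
  using region_lower_cell lower_cell_openin by blast

text \<open>Ideals can only shrink in the limit: the region of \<open>x\<close> is a relative
  neighbourhood of \<open>x\<close>, so it contains points whose ideal is
  \<open>J \<mu>\<close>.\<close>

lemma J_subset_of_closure_constancy_region:
  assumes "x \<in> orthant" "x \<in> closure (constancy_region J \<mu>)"
  shows "J x \<subseteq> J \<mu>"
proof -
  obtain U where U: "open U" "region J x = orthant \<inter> U"
    using openin_region[OF assms(1)] by (auto simp: openin_open)
  have "x \<in> region J x" using assms(1) by (simp add: region_def)
  then obtain y where y: "y \<in> U" "y \<in> constancy_region J \<mu>"
    using open_Int_closure_eq_empty[OF U(1), of "constancy_region J \<mu>"] assms(2) U(2) by blast
  then have "y \<in> region J x" using U(2) by (auto simp: constancy_region_def)
  then show ?thesis using y(2) by (auto simp: region_def constancy_region_def)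
qed

text \<open>
  A linear form that is at most \<open>\<beta>\<close> on a facet and attains \<open>\<beta>\<close> in an interior point of the facet
  is constant on it; hence the same elements of \<^term>\<open>J \<mu>\<close> are lost at all its interior points.
\<close>
lemma J_subset_on_facet:
  assumes sub: "J x \<subseteq> J \<mu>" and "\<Phi> \<subseteq> closure (region J \<mu>)" "affine H" "x \<in> H"
    and y: "y \<in> (top_of_set H) interior_of \<Phi>"
  shows "J x \<subseteq> J y"
proof
  fix f assume f: "f \<in> J x"
  show "f \<in> J y"
  proof (cases "f \<in> Z")
    case False
    have "c w \<bullet> y < \<kappa> w + of_int (v w f)" if w: "w \<in> B" for w
    proof (rule ccontr)
      let ?\<beta> = "\<kappa> w + of_int (v w f)"
      assume ge: "\<not> c w \<bullet> y < ?\<beta>"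
      have x_less: "c w \<bullet> x < ?\<beta>" using f False w by (auto simp: J_eq)
      have "region J \<mu> \<subseteq> {p. c w \<bullet> p \<le> ?\<beta>}"
        using f sub False w by (fastforce simp: region_def J_eq)
      then have le: "c w \<bullet> p \<le> ?\<beta>" if "p \<in> \<Phi>" for p
        using closure_minimal[OF _ closed_halfspace_le] that assms(2) by blast
      obtain U where U: "open U" "y \<in> U" "y \<in> H" "H \<inter> U \<subseteq> \<Phi>"
        using y by (auto simp: interior_of_def openin_open)
      have "open ((\<lambda>d. y + d *\<^sub>R (y - x)) -` U)"
        using U(1) by (intro open_vimage continuous_intros)
      moreover have "(0::real) \<in> (\<lambda>d. y + d *\<^sub>R (y - x)) -` U" using U(2) by simp
      ultimately obtain e where e: "e > 0" "ball 0 e \<subseteq> (\<lambda>d. y + d *\<^sub>R (y - x)) -` U"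
        using openE by blast
      \<comment> \<open>Prolonging the segment from \<open>x\<close> slightly beyond
        \<open>y\<close> stays in the facet. The form is below \<open>?\<beta>\<close> at
        \<open>x\<close> and at least \<open>?\<beta>\<close> at \<open>y\<close>, so at
        \<open>?p\<close> it would violate \<open>le\<close>.\<close>
      let ?p = "y + (e/2) *\<^sub>R (y - x)"
      have "?p \<in> U" using e by (force simp: dist_real_def)
      moreover have "?p \<in> H"
      proof -
        have "?p = (1 + e/2) *\<^sub>R y + (- e/2) *\<^sub>R x" by (simp add: algebra_simps)
        also have "\<dots> \<in> H" by (rule mem_affine[OF \<open>affine H\<close> U(3) \<open>x \<in> H\<close>]) simp
        finally show ?thesis .
      qed
      ultimately have "c w \<bullet> ?p \<le> ?\<beta>" using U(4) le by blast
      moreover have "c w \<bullet> ?p = c w \<bullet> y + (e/2) * (c w \<bullet> y - c w \<bullet> x)"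
        by (simp add: inner_add_right inner_diff_right)
      moreover have "0 < (e/2) * (c w \<bullet> y - c w \<bullet> x)"
        using e(1) ge x_less by simp
      ultimately show False using ge by linarith
    qed
    moreover have "f \<in> G" using f False by (auto simp: J_eq)
    ultimately show ?thesis by (auto simp: J_eq)
  qed (simp add: J_eq)
qed

end

section \<open>Runs of the algorithm\<close>

lemma selection_step_result:
  fixes J :: "real ^ 'r::finite \<Rightarrow> 'a set"
  assumes "selection_step J N N'"
  shows "set N' = set N"
    and "N' = l # r \<Longrightarrow> z \<in> set N \<Longrightarrow> z \<in> region J l \<Longrightarrow> J z = J l"
proof -
  have moves: "(move_to_front J)\<^sup>*\<^sup>* N N'" and final: "\<not> (\<exists>N''. move_to_front J N' N'')"
    using assms by (auto simp: selection_step_def)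
  from moves show set_eq: "set N' = set N"
  proof (induction rule: rtranclp_induct)
    case (step N1 N2)
    have "set (z # remove1 z xs) = set xs" if "z \<in> set xs" for z :: "real ^ 'r" and xs
      using that by (induction xs) auto
    then have "set N2 = set N1" using step(2) unfolding move_to_front_def by blast
    then show ?case using step(3) by simp
  qed simp
  show "J z = J l" if "N' = l # r" "z \<in> set N" "z \<in> region J l"
  proof (rule ccontr)
    assume "J z \<noteq> J l"
    then have "move_to_front J N' (z # remove1 z N')"
      using that set_eq unfolding move_to_front_def by auto
    then show False using final by blast
  qed
qed

lemma one_interior_point_each_D:
  assumes "one_interior_point_each Rg \<F> ps"
  shows "z \<in> set ps \<Longrightarrow> \<exists>\<Phi>\<in>\<F>. z \<in> facet_interior_points Rg \<Phi>"
    and "\<Phi> \<in> \<F> \<Longrightarrow> \<exists>z\<in>set ps. z \<in> facet_interior_points Rg \<Phi>"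
proof -
  obtain fs pick where "set fs = \<F>" "\<forall>\<Phi>\<in>\<F>. pick \<Phi> \<in> facet_interior_points Rg \<Phi>" "ps = map pick fs"
    using assms unfolding one_interior_point_each_def by blast
  then show "z \<in> set ps \<Longrightarrow> \<exists>\<Phi>\<in>\<F>. z \<in> facet_interior_points Rg \<Phi>"
    and "\<Phi> \<in> \<F> \<Longrightarrow> \<exists>z\<in>set ps. z \<in> facet_interior_points Rg \<Phi>"
    by auto
qed

lemma affine_supporting_hyperplane: "H \<in> supporting_hyperplanes Rg \<Longrightarrow> affine H"
  by (auto simp: supporting_hyperplanes_def)

lemma facets_of_components_subset:
  assumes "\<Phi> \<in> facets_of_components C Rg" "C \<subseteq> orthant"
  shows "\<Phi> \<subseteq> closure C" "\<Phi> \<subseteq> orthant"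
proof -
  obtain S where S: "S \<in> components C" "\<Phi> \<subseteq> orthant_boundary S"
    using assms(1) by (auto simp: facets_of_components_def)
  have "S \<subseteq> C" using S(1) by (rule in_components_subset)
  then have "orthant_boundary S \<subseteq> closure S"
    using orthant_boundary_iff[of S] assms(2) by blast
  then show "\<Phi> \<subseteq> closure C" using S(2) closure_mono[OF \<open>S \<subseteq> C\<close>] by blast
  then show "\<Phi> \<subseteq> orthant" using closure_minimal[OF assms(2) closed_orthant] by blast
qed

context threshold_family
begin

context
  fixes n N D lam rest added
  assumes run: "algorithm_run J n N D lam rest added"
begin

lemma
  assumes "i < n"
  shows run_select: "selection_step J (N i) (lam i # rest i)"
    and run_added: "new_ideal J (D i) (lam i) \<Longrightarrow> one_interior_point_each (region J (lam i))
                (facets_of_components (computed_region J lam i) (region J (lam i))) (added i)"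
    and run_not_added: "\<not> new_ideal J (D i) (lam i) \<Longrightarrow> added i = []"
    and run_N: "N (Suc i) = rest i @ added i"
  using run assms unfolding algorithm_run_def by meson+

lemma run_set_N: "i < n \<Longrightarrow> set (N i) = insert (lam i) (set (rest i))"
  using selection_step_result(1)[OF run_select] by simp

lemma run_D: "i \<le> n \<Longrightarrow> set (D i) = lam ` {..<i}"
proof (induction i)
  case 0
  then show ?case using run by (simp add: algorithm_run_def)
next
  case (Suc i)
  then have "D (Suc i) = D i @ [lam i]" using run by (simp add: algorithm_run_def)
  then show ?case using Suc by (simp add: lessThan_Suc)
qed

text \<open>Every chosen point enters \<open>D\<close>, also when (j.3) is skipped, so the test
  compares with all earlier steps.\<close>

lemma new_ideal_iff: "i \<le> n \<Longrightarrow> new_ideal J (D i) z \<longleftrightarrow> (\<forall>k<i. J (lam k) \<noteq> J z)"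
  by (auto simp: new_ideal_def run_D)

lemma computed_region_subset_orthant: "computed_region J lam k \<subseteq> orthant"
  by (auto simp: computed_region_def region_def)

section \<open>Location of the added points and their time on the list\<close>

lemma added_point:
  assumes "k < n" "z \<in> set (added k)"
  obtains \<Phi> H where "new_ideal J (D k) (lam k)"
    "\<Phi> \<in> facets_of_components (computed_region J lam k) (region J (lam k))"
    "H \<in> supporting_hyperplanes (region J (lam k))" "\<Phi> \<subseteq> H"
    "z \<in> (top_of_set H) interior_of \<Phi>"
proof -
  have new: "new_ideal J (D k) (lam k)"
    using run_not_added[OF assms(1)] assms(2) by force
  obtain \<Phi> where \<Phi>: "\<Phi> \<in> facets_of_components (computed_region J lam k) (region J (lam k))"
    "z \<in> facet_interior_points (region J (lam k)) \<Phi>"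
    using one_interior_point_each_D(1)[OF run_added[OF assms(1) new] assms(2)] by blast
  then show thesis
    using that[OF new \<Phi>(1)] unfolding facet_interior_points_def by blast
qed

text \<open>For \<open>i = k\<close> the supporting hyperplane misses the region. For earlier
  \<open>i\<close> the computed region avoids a relatively open set, and so does its closure within
  the orthant, which contains the facet.\<close>

lemma added_point_outside:
  assumes "k < n" "z \<in> set (added k)" and lam: "\<And>i. i \<le> k \<Longrightarrow> lam i \<in> orthant"
  shows "z \<in> orthant" "\<And>i. i \<le> k \<Longrightarrow> z \<notin> region J (lam i)"
proof -
  obtain \<Phi> H where \<Phi>: "\<Phi> \<in> facets_of_components (computed_region J lam k) (region J (lam k))"
    and H: "H \<in> supporting_hyperplanes (region J (lam k))" "\<Phi> \<subseteq> H"
    and z: "z \<in> (top_of_set H) interior_of \<Phi>"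
    using added_point[OF assms(1,2)] by metis
  have "z \<in> \<Phi>" using z interior_of_subset by fast
  then show "z \<in> orthant"
    using facets_of_components_subset(2)[OF \<Phi> computed_region_subset_orthant] by blast
  have "z \<in> closure (computed_region J lam k)"
    using facets_of_components_subset(1)[OF \<Phi> computed_region_subset_orthant] \<open>z \<in> \<Phi>\<close> by blast
  show "z \<notin> region J (lam i)" if "i \<le> k" for i
  proof (cases "i = k")
    case True
    obtain A where "lower_cell A (region J (lam k))"
      using region_lower_cell lam by blast
    then show ?thesis
      using lower_cell_disjoint_supporting_hyperplane[OF _ H(1)] H(2) \<open>z \<in> \<Phi>\<close> True by blast
  next
    case False
    then have "i < k" and ik: "i \<le> k" using that by simp_all
    obtain U where U: "open U" "region J (lam i) = orthant \<inter> U"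
      using openin_region[OF lam[OF ik]] by (auto simp: openin_open)
    have "computed_region J lam k \<inter> region J (lam i) = {}"
      using \<open>i < k\<close> by (auto simp: computed_region_def)
    then have "U \<inter> computed_region J lam k = {}"
      using U(2) computed_region_subset_orthant by blast
    then have "U \<inter> closure (computed_region J lam k) = {}"
      using open_Int_closure_eq_empty[OF U(1)] by blast
    then show ?thesis using \<open>z \<in> closure _\<close> U(2) by blast
  qed
qed

text \<open>The step \<open>m\<close> is an arrival time of \<open>z\<close>: points chosen before
  it do not cover \<open>z\<close>, later ones find \<open>z\<close> listed. Membership in the
  orthant joins the induction because regions are known to be cells only for points of the
  orthant.\<close>

lemma listed_point:
  assumes "j < n" "z \<in> set (N j)"
  shows "z \<in> orthant \<and> (\<exists>m\<le>j. (\<forall>i\<in>{m..j}. z \<in> set (N i)) \<and> (\<forall>i<m. z \<notin> region J (lam i)))"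
  using assms
proof (induction j arbitrary: z rule: less_induct)
  case (less j)
  show ?case
  proof (cases j)
    case 0
    then have "z = 0" using less.prems run by (simp add: algorithm_run_def)
    then show ?thesis using less.prems 0 by (auto simp: orthant_def)
  next
    case (Suc k)
    have k: "k < n" "k < j" using Suc less.prems by auto
    have lam: "lam i \<in> orthant" if "i \<le> k" for i
      using less.IH[of i "lam i"] run_set_N[of i] that k by auto
    consider "z \<in> set (rest k)" | "z \<in> set (added k)"
      using run_N[OF k(1)] less.prems Suc by auto
    then show ?thesis
    proof cases
      case 1
      then have "z \<in> set (N k)" using run_set_N[OF k(1)] by auto
      from less.IH[OF k(2,1) this] obtain m where m: "z \<in> orthant" "m \<le> k"
        "\<forall>i\<in>{m..k}. z \<in> set (N i)" "\<forall>i<m. z \<notin> region J (lam i)" by blast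
      then have "\<forall>i\<in>{m..j}. z \<in> set (N i)" using less.prems Suc by (auto simp: le_Suc_eq)
      moreover have "m \<le> j" using m(2) Suc by simp
      ultimately show ?thesis using m(1,4) by blast
    next
      case 2
      then show ?thesis
        using added_point_outside[OF k(1) 2 lam] less.prems Suc
        by (intro conjI exI[of _ j]) auto
    qed
  qed
qed

lemma lam_orthant: "j < n \<Longrightarrow> lam j \<in> orthant"
  using listed_point run_set_N by blast

text \<open>Before the arrival time this is \<open>listed_point\<close>. From then on
  \<open>lam j\<close> was listed when \<open>lam i\<close> was selected, so lying in its region
  would force equal ideals, against \<open>new_ideal\<close>.\<close>

lemma lam_outside_earlier_regions:
  assumes "j < n" "new_ideal J (D j) (lam j)" "i < j"
  shows "lam j \<notin> region J (lam i)"
proof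
  assume in_region: "lam j \<in> region J (lam i)"
  obtain m where m: "\<forall>i\<in>{m..j}. lam j \<in> set (N i)" "\<forall>i<m. lam j \<notin> region J (lam i)"
    using listed_point[OF assms(1)] run_set_N[OF assms(1)] by blast
  then have "m \<le> i" using in_region by (metis not_le)
  then have "lam j \<in> set (N i)" using m(1) assms(3) by auto
  then have "J (lam j) = J (lam i)"
    using selection_step_result(2)[OF run_select refl] in_region assms by auto
  then show False using assms new_ideal_iff[of j] by auto
qed

lemma remains_listed:
  assumes "z \<in> set (N m)" "m \<le> j" "j \<le> n" "\<And>i. m \<le> i \<Longrightarrow> i < j \<Longrightarrow> z \<noteq> lam i"
  shows "z \<in> set (N j)"
  using assms(2,3,4)
proof (induction j rule: dec_induct)
  case (step k)
  then have "z \<in> set (N k)" by auto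
  then show ?case using run_set_N[of k] run_N[of k] step by auto
qed (rule assms(1))

text \<open>This keeps points with too large an ideal out of \<open>computed_region\<close>. The
  assumption \<open>constancy\<close> is the induction hypothesis; it places the exit facet in the
  closure of a set with constant ideal.\<close>

lemma larger_ideals_covered:
  assumes j: "j < n"
    and constancy: "\<And>k. k < j \<Longrightarrow> new_ideal J (D k) (lam k) \<Longrightarrow>
      computed_region J lam k = constancy_region J (lam k)"
    and z: "z \<in> orthant" "J (lam j) \<subset> J z"
  shows "\<exists>i<j. z \<in> region J (lam i)"
proof (rule ccontr)
  assume "\<not> ?thesis"
  then have notin: "z \<notin> region J (lam i)" if "i < j" for i using that by blast
  \<comment> \<open>At step 0 the only listed point is the origin, whose ideal is the
    largest.\<close>
  have "0 < j"
  proof (rule ccontr)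
    assume "\<not> 0 < j"
    then have "lam j \<in> set (N 0)" using run_set_N[OF j] by simp
    then have "lam j = 0" using run by (simp add: algorithm_run_def)
    then have "J z \<subseteq> J (lam j)" using z(1) by (intro J_antimono) (simp add: orthant_def)
    then show False using z(2) by blast
  qed
  have "\<forall>i. \<exists>A. i < j \<longrightarrow> lower_cell A (region J (lam i))"
    using region_lower_cell lam_orthant j by (meson less_trans)
  then obtain A where A: "\<And>i. i < j \<Longrightarrow> lower_cell (A i) (region J (lam i))" by metis
  obtain U where U: "open U" "region J z = orthant \<inter> U"
    using openin_region[OF z(1)] by (auto simp: openin_open)
  have "z \<in> U" using z(1) U(2) by (auto simp: region_def)
  obtain y t k S H where y: "y \<in> U" "y \<in> orthant" and t: "0 < t" "t \<le> 1" and "k < j"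
    and distinct_regions: "\<And>i. i < k \<Longrightarrow> region J (lam i) \<noteq> region J (lam k)"
    and outside: "\<And>i. i < j \<Longrightarrow> t *\<^sub>R y \<notin> region J (lam i)"
    and S: "S \<in> components (region J (lam k) - (\<Union>i<k. region J (lam i)))"
    and H: "H \<in> supporting_hyperplanes (region J (lam k))"
    and int: "t *\<^sub>R y \<in> (top_of_set H) interior_of (orthant_boundary S \<inter> H)"
    by (rule exit_through_facet[OF A \<open>0 < j\<close> z(1) notin U(1) \<open>z \<in> U\<close>]) blast+
  define \<mu> where "\<mu> = t *\<^sub>R y"
  define \<Phi> where "\<Phi> = orthant_boundary S \<inter> H"
  have "k < n" using \<open>k < j\<close> j by simp
  \<comment> \<open>The perturbation stays in the region of \<open>z\<close>, and moving back
    towards the origin can only enlarge the ideal.\<close>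
  have "J z \<subseteq> J y" using y U(2) by (auto simp: region_def)
  also have "J y \<subseteq> J \<mu>"
    using y(2) t by (intro J_antimono) (auto simp: \<mu>_def orthant_def intro: mult_left_le_one_le)
  finally have larger: "J (lam j) \<subset> J \<mu>" using z(2) by blast
  \<comment> \<open>Equal ideals have equal regions, so an earlier point with the ideal of
    \<open>lam k\<close> would contradict \<open>distinct_regions\<close>.\<close>
  have new: "new_ideal J (D k) (lam k)"
    using distinct_regions \<open>k < n\<close> by (auto simp: new_ideal_iff region_def)
  have eq: "computed_region J lam k = constancy_region J (lam k)"
    using constancy \<open>k < j\<close> new by blast
  have \<Phi>: "\<Phi> \<in> facets_of_components (computed_region J lam k) (region J (lam k))"
    unfolding facets_of_components_def using S H int
    by (auto simp: \<Phi>_def computed_region_def)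
  obtain p where p: "p \<in> set (added k)" "p \<in> facet_interior_points (region J (lam k)) \<Phi>"
    using one_interior_point_each_D(2)[OF run_added[OF \<open>k < n\<close> new] \<Phi>] by blast
  then obtain H' where H': "H' \<in> supporting_hyperplanes (region J (lam k))" "\<Phi> \<subseteq> H'"
    "p \<in> (top_of_set H') interior_of \<Phi>"
    by (auto simp: facet_interior_points_def)
  have "\<mu> \<in> (top_of_set H) interior_of \<Phi>" using int by (simp add: \<mu>_def \<Phi>_def)
  moreover have "p \<in> \<Phi>" using H'(3) interior_of_subset by fast
  moreover have "\<mu> \<in> \<Phi>" using calculation(1) interior_of_subset by fast
  ultimately have mem: "\<mu> \<in> (top_of_set H) interior_of \<Phi>" "p \<in> \<Phi>" "\<mu> \<in> \<Phi>" .
  have sub: "\<Phi> \<subseteq> closure (constancy_region J (lam k))" "\<Phi> \<subseteq> orthant"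
    using facets_of_components_subset[OF \<Phi> computed_region_subset_orthant] eq by auto
  have "constancy_region J (lam k) \<subseteq> region J (lam k)"
    by (auto simp: constancy_region_def region_def)
  then have sub': "\<Phi> \<subseteq> closure (region J (lam k))" using sub(1) closure_mono by blast
  have below: "J x \<subseteq> J (lam k)" if "x \<in> \<Phi>" for x
    using J_subset_of_closure_constancy_region that sub by blast
  have "p \<in> H" using mem(2) by (simp add: \<Phi>_def)
  \<comment> \<open>The facet comparison is applied in both directions, as \<open>p\<close> and
    \<open>\<mu>\<close> are both interior points of \<open>\<Phi>\<close>, with respect to
    \<open>H'\<close> and \<open>H\<close>.\<close>
  have "J p \<subseteq> J \<mu>"
    using J_subset_on_facet[OF below[OF mem(2)] sub' affine_supporting_hyperplane[OF H] \<open>p \<in> H\<close> mem(1)] .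
  moreover have "J \<mu> \<subseteq> J p"
    using J_subset_on_facet[OF below[OF mem(3)] sub' affine_supporting_hyperplane[OF H'(1)] _ H'(3)]
      H'(2) mem(3) by blast
  ultimately have J_eq_p: "J p = J \<mu>" by simp
  \<comment> \<open>Had \<open>p\<close> been chosen before step \<open>j\<close>, its region would
    contain the exit point, which has the same ideal. So \<open>p\<close> is still listed at step
    \<open>j\<close>.\<close>
  have "p \<noteq> lam i" if "i < j" for i
    using outside[OF that] J_eq_p sub(2) mem(3) by (auto simp: region_def \<mu>_def)
  moreover have "p \<in> set (N (Suc k))" using p(1) run_N[OF \<open>k < n\<close>] by simp
  ultimately have "p \<in> set (N j)"
    using remains_listed[of p "Suc k" j] \<open>k < j\<close> j by simp
  moreover have "p \<in> region J (lam j)"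
    using larger J_eq_p sub(2) mem(2) by (auto simp: region_def)
  ultimately have "J p = J (lam j)"
    using selection_step_result(2)[OF run_select[OF j] refl] by blast
  then show False using larger J_eq_p by simp
qed

text \<open>Points with a strictly larger ideal are covered by earlier regions. An earlier region
  containing a point with the ideal of \<open>lam j\<close> would contain \<open>lam j\<close>
  itself.\<close>

lemma computed_region_eq_constancy_region:
  assumes "j < n" "new_ideal J (D j) (lam j)"
  shows "computed_region J lam j = constancy_region J (lam j)"
  using assms
proof (induction j rule: less_induct)
  case (less j)
  have constancy: "computed_region J lam k = constancy_region J (lam k)"
    if "k < j" "new_ideal J (D k) (lam k)" for k
    using less that by simp
  show ?case
  proof
    show "computed_region J lam j \<subseteq> constancy_region J (lam j)"
    proof
      fix z assume z: "z \<in> computed_region J lam j"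
      then have "z \<in> orthant" "J (lam j) \<subseteq> J z" by (auto simp: computed_region_def region_def)
      moreover have "\<not> (\<exists>i<j. z \<in> region J (lam i))" using z by (auto simp: computed_region_def)
      ultimately show "z \<in> constancy_region J (lam j)"
        using larger_ideals_covered[OF less.prems(1) constancy] by (fastforce simp: constancy_region_def)
    qed
    show "constancy_region J (lam j) \<subseteq> computed_region J lam j"
      using lam_outside_earlier_regions[OF less.prems] lam_orthant[OF less.prems(1)]
      by (auto simp: computed_region_def constancy_region_def region_def)
  qed
qed

end

end

section \<open>Mixed multiplier ideals as a threshold family\<close>

theorem theorem3p15:
  fixes \<iota> :: "complex \<Rightarrow> 'k::field"
    and R :: "'k set"
    and a :: "'r::finite \<Rightarrow> 'k set"
    and X :: "'k set set"
    and F :: "'r \<Rightarrow> 'k set \<Rightarrow> int"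
    and K :: "'k set \<Rightarrow> rat"
    and J :: "real ^ 'r \<Rightarrow> 'k set"
    and N D rest added :: "nat \<Rightarrow> (real ^ 'r) list"
    and lam :: "nat \<Rightarrow> real ^ 'r"
    and n j :: nat
  assumes "normal_surface_point \<iota> R"
    and "rational_singularity R"
    and "\<forall>i. ideal (a i) (ring_on R) \<and> a i \<noteq> {0}"
    and "log_resolution \<iota> R a X F"
    and "relative_canonical_divisor R X K"
    and "J = mixed_multiplier_ideal X F K"
    and "algorithm_run J n N D lam rest added"
    and "j < n"
    and "new_ideal J (D j) (lam j)"
  shows "computed_region J lam j = constancy_region J (lam j) \<and>
         one_interior_point_each (region J (lam j)) (C_facets J (lam j)) (added j)"
proof -
  \<comment> \<open>Only finitely many prime divisors occur in the \<open>F i\<close>; along the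
    others the condition is independent of \<open>z\<close> and goes into \<open>G\<close>.\<close>
  define B where "B = {V \<in> prime_divisors X. \<exists>i. F i V \<noteq> 0}"
  define G where "G = {f. \<forall>V\<in>prime_divisors X - B. 0 \<le> vord V f + \<lceil>real_of_rat (K V)\<rceil>}"
  define c :: "'k set \<Rightarrow> real ^ 'r" where "c V = (\<chi> i. of_int (F i V))" for V
  have divisor: "divisor X (F i)" "0 \<le> F i V" for i V
    using assms(4) by (auto simp: log_resolution_def)
  have inner: "(\<Sum>i\<in>UNIV. z $ i * of_int (F i V)) = c V \<bullet> z" for V and z :: "real ^ 'r"
    by (simp add: c_def inner_vec_def mult.commute)
  interpret threshold_family J "{0}" G B c "\<lambda>V. real_of_rat (K V) + 1" vord
  proof
    show "finite B"
    proof (rule finite_subset)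
      show "B \<subseteq> (\<Union>i. {V. F i V \<noteq> 0})" by (auto simp: B_def)
      show "finite (\<Union>i. {V. F i V \<noteq> 0})" using divisor(1) by (auto simp: divisor_def)
    qed
    show "0 \<le> c V $ i" for V i using divisor(2) by (simp add: c_def)
  next
    fix z :: "real ^ 'r"
    \<comment> \<open>A prime divisor is itself a point of \<open>X\<close>, so for global sections
      every prime divisor counts.\<close>
    have in_X: "\<exists>P\<in>X. P \<subseteq> V" if "V \<in> prime_divisors X" for V
      using that by (auto simp: prime_divisors_def)
    \<comment> \<open>For an integer \<open>m\<close>, \<open>0 \<le> m + \<lceil>x\<rceil>\<close>
      holds iff \<open>- m - 1 < x\<close>; this is the source of the \<open>+ 1\<close> and of the
      strict inequality.\<close>
    have ceiling_iff: "0 \<le> vord V f + \<lceil>real_of_rat (K V) - c V \<bullet> z\<rceil> \<longleftrightarrow>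
        c V \<bullet> z < real_of_rat (K V) + 1 + of_int (vord V f)" for V f
      by linarith
    have c_zero: "c V = 0" if "V \<in> prime_divisors X - B" for V
      using that by (simp add: B_def c_def vec_eq_iff)
    have split: "(\<forall>V\<in>prime_divisors X. P V) \<longleftrightarrow>
        (\<forall>V\<in>prime_divisors X - B. P V) \<and> (\<forall>V\<in>B. P V)" for P
      by (auto simp: B_def)
    have "f \<in> J z \<longleftrightarrow> f = 0 \<or>
        (\<forall>V\<in>prime_divisors X. 0 \<le> vord V f + \<lceil>real_of_rat (K V) - c V \<bullet> z\<rceil>)" for f
      using in_X unfolding assms(6) mixed_multiplier_ideal_def divisorial_sheaf_def inner by auto
    also have "\<dots> f \<longleftrightarrow> f \<in> {0} \<union>
        {f \<in> G. \<forall>V\<in>B. c V \<bullet> z < real_of_rat (K V) + 1 + of_int (vord V f)}" for f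
      unfolding split ceiling_iff[symmetric] by (auto simp: G_def c_zero)
    finally show "J z = {0} \<union>
        {f \<in> G. \<forall>V\<in>B. c V \<bullet> z < real_of_rat (K V) + 1 + of_int (vord V f)}"
      by blast
  qed
  have "computed_region J lam j = constancy_region J (lam j)"
    by (rule computed_region_eq_constancy_region[OF assms(7-9)])
  \<comment> \<open>Outer facets and \<open>C_facets\<close> are formed with the same
    \<open>region\<close>, so equality of the two sets identifies them.\<close>
  then show ?thesis
    using run_added[OF assms(7-9)] by (simp add: C_facets_def)
qed

end
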